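(* The embedding $\eta:\mathbb{S}^5\to\mathrm{SU}(3)$ given by $$\eta(z)= z z^t+\begin{pmatrix}0&-\bar z_3&\bar z_2\\ \bar z_3&0&-\bar z_1\\ -\bar z_2&\bar z_1&0\end{pmatrix}$$ parametrizes a minimal submanifold of $\mathrm{SU}(3)$, where $\mathrm{SU}(3)$ carries a bi-invariant Riemannian metric.
   Context: $\mathbb{S}^5$ is the unit sphere in $\mathbb{C}^3$, $z=(z_1,z_2,z_3)^t$ is a column vector, and $z^t$ is its transpose (without conjugation). A submanifold is minimal if it is a critical point of the volume functional, i.e. if its mean curvature vanishes. *)

theory Defs
  imports "HOL-Analysis.Analysis"
begin

section \<open>Smooth maps on subsets of Euclidean spaces\<close>

text \<open>
  Manifolds are embedded submanifolds of Euclidean spaces, represented by their carrier sets.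
\<close>

primrec Ck_on :: "nat \<Rightarrow> 'a::euclidean_space set \<Rightarrow> ('a \<Rightarrow> 'b::real_normed_vector) \<Rightarrow> bool" where
  "Ck_on 0 U f \<longleftrightarrow> continuous_on U f"
| "Ck_on (Suc k) U f \<longleftrightarrow>
     (\<forall>x\<in>U. f differentiable (at x)) \<and> (\<forall>v. Ck_on k U (\<lambda>x. frechet_derivative f (at x) v))"

definition smooth_on_open :: "'a::euclidean_space set \<Rightarrow> ('a \<Rightarrow> 'b::real_normed_vector) \<Rightarrow> bool" where
  "smooth_on_open U f \<longleftrightarrow> open U \<and> (\<forall>k. Ck_on k U f)"

definition smooth_map :: "'a::euclidean_space set \<Rightarrow> ('a \<Rightarrow> 'b::real_normed_vector) \<Rightarrow> bool" where
  "smooth_map M f \<longleftrightarrow>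
     (\<forall>p\<in>M. \<exists>U F. p \<in> U \<and> smooth_on_open U F \<and> (\<forall>x\<in>M \<inter> U. F x = f x))"

definition tangent_space :: "'a::euclidean_space set \<Rightarrow> 'a \<Rightarrow> 'a set" where
  "tangent_space M p =
     {v. \<exists>(c :: real \<Rightarrow> 'a) e. e > 0 \<and> smooth_on_open {-e<..<e} c \<and> c ` {-e<..<e} \<subseteq> M \<and>
           c 0 = p \<and> (c has_vector_derivative v) (at 0)}"

text \<open>
  The derivative within \<open>M\<close> is not unique as a linear map on the ambient space, but on vectors
  tangent to \<open>M\<close> all its choices agree (compose with a curve in \<open>M\<close>). It is only ever
  applied to such vectors, where it is the differential of a smooth map on the manifold \<open>M\<close>.
\<close>

abbreviation differential ::
  "'a::euclidean_space set \<Rightarrow> ('a \<Rightarrow> 'b::real_normed_vector) \<Rightarrow> 'a \<Rightarrow> 'a \<Rightarrow> 'b" where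
  "differential M f p \<equiv> frechet_derivative f (at p within M)"

definition smooth_embedding ::
  "'a::euclidean_space set \<Rightarrow> 'b::euclidean_space set \<Rightarrow> ('a \<Rightarrow> 'b) \<Rightarrow> bool" where
  "smooth_embedding N M f \<longleftrightarrow>
     f ` N \<subseteq> M \<and> smooth_map N f \<and>
     (\<forall>p\<in>N. inj_on (differential N f p) (tangent_space N p)) \<and>
     (\<exists>h. homeomorphism N (f ` N) f h)"


section \<open>Vector fields, Riemannian metrics and the Levi-Civita connection\<close>

text \<open>Only the values of a vector field at points of \<open>M\<close> are relevant.\<close>

definition vector_fields :: "'a::euclidean_space set \<Rightarrow> ('a \<Rightarrow> 'a) set" where
  "vector_fields M = {X. smooth_map M X \<and> (\<forall>p\<in>M. X p \<in> tangent_space M p)}"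

definition lie_bracket ::
  "'a::euclidean_space set \<Rightarrow> ('a \<Rightarrow> 'a) \<Rightarrow> ('a \<Rightarrow> 'a) \<Rightarrow> 'a \<Rightarrow> 'a" where
  "lie_bracket M X Y p = differential M Y p (X p) - differential M X p (Y p)"

definition riemannian_metric ::
  "'a::euclidean_space set \<Rightarrow> ('a \<Rightarrow> 'a \<Rightarrow> 'a \<Rightarrow> real) \<Rightarrow> bool" where
  "riemannian_metric M g \<longleftrightarrow>
     (\<forall>p\<in>M. \<forall>u\<in>tangent_space M p. \<forall>v\<in>tangent_space M p. g p u v = g p v u) \<and>
     (\<forall>p\<in>M. \<forall>u\<in>tangent_space M p. \<forall>v\<in>tangent_space M p. \<forall>w\<in>tangent_space M p. \<forall>a.
        g p (a *\<^sub>R u + v) w = a * g p u w + g p v w) \<and>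
     (\<forall>p\<in>M. \<forall>u\<in>tangent_space M p. u \<noteq> 0 \<longrightarrow> g p u u > 0) \<and>
     (\<forall>X\<in>vector_fields M. \<forall>Y\<in>vector_fields M. smooth_map M (\<lambda>p. g p (X p) (Y p)))"

definition is_levi_civita ::
  "'a::euclidean_space set \<Rightarrow> ('a \<Rightarrow> 'a \<Rightarrow> 'a \<Rightarrow> real) \<Rightarrow>
   (('a \<Rightarrow> 'a) \<Rightarrow> ('a \<Rightarrow> 'a) \<Rightarrow> 'a \<Rightarrow> 'a) \<Rightarrow> bool" where
  "is_levi_civita M g nabla \<longleftrightarrow>
     (\<forall>X\<in>vector_fields M. \<forall>Y\<in>vector_fields M. nabla X Y \<in> vector_fields M) \<and>
     (\<forall>X\<in>vector_fields M. \<forall>X'\<in>vector_fields M. \<forall>Y\<in>vector_fields M. \<forall>f :: 'a \<Rightarrow> real.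
        smooth_map M f \<longrightarrow>
        (\<forall>p\<in>M. nabla (\<lambda>q. f q *\<^sub>R X q + X' q) Y p = f p *\<^sub>R nabla X Y p + nabla X' Y p)) \<and>
     (\<forall>X\<in>vector_fields M. \<forall>Y\<in>vector_fields M. \<forall>Y'\<in>vector_fields M. \<forall>f :: 'a \<Rightarrow> real.
        smooth_map M f \<longrightarrow>
        (\<forall>p\<in>M. nabla X (\<lambda>q. f q *\<^sub>R Y q + Y' q) p =
                 differential M f p (X p) *\<^sub>R Y p + f p *\<^sub>R nabla X Y p + nabla X Y' p)) \<and>
     (\<forall>X\<in>vector_fields M. \<forall>Y\<in>vector_fields M. \<forall>p\<in>M.
        nabla X Y p - nabla Y X p = lie_bracket M X Y p) \<and>
     (\<forall>X\<in>vector_fields M. \<forall>Y\<in>vector_fields M. \<forall>Z\<in>vector_fields M. \<forall>p\<in>M.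
        differential M (\<lambda>q. g q (Y q) (Z q)) p (X p) =
          g p (nabla X Y p) (Z p) + g p (Y p) (nabla X Z p))"

text \<open>
  By the fundamental theorem of Riemannian geometry the choice below exists, and its values
  at points of \<open>M\<close> on vector fields of \<open>M\<close> are unique.
\<close>

definition levi_civita ::
  "'a::euclidean_space set \<Rightarrow> ('a \<Rightarrow> 'a \<Rightarrow> 'a \<Rightarrow> real) \<Rightarrow>
   ('a \<Rightarrow> 'a) \<Rightarrow> ('a \<Rightarrow> 'a) \<Rightarrow> 'a \<Rightarrow> 'a" where
  "levi_civita M g = (SOME nabla. is_levi_civita M g nabla)"


section \<open>Second fundamental form and mean curvature of \<open>S \<subseteq> M\<close>\<close>

definition normal_part ::
  "'a::euclidean_space set \<Rightarrow> ('a \<Rightarrow> 'a \<Rightarrow> 'a \<Rightarrow> real) \<Rightarrow> 'a set \<Rightarrow> 'a \<Rightarrow> 'a \<Rightarrow> 'a" where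
  "normal_part M g S p w =
     (THE n. n \<in> tangent_space M p \<and> (\<forall>t\<in>tangent_space S p. g p n t = 0) \<and>
             w - n \<in> tangent_space S p)"

definition tangential_extension ::
  "'a::euclidean_space set \<Rightarrow> 'a set \<Rightarrow> 'a \<Rightarrow> 'a \<Rightarrow> ('a \<Rightarrow> 'a) \<Rightarrow> bool" where
  "tangential_extension M S p u U \<longleftrightarrow>
     U \<in> vector_fields M \<and> (\<forall>q\<in>S. U q \<in> tangent_space S q) \<and> U p = u"

text \<open>
  The usual \<open>II(u, v) = (\<nabla>\<^sub>U V)\<^sup>\<bottom>\<close>, which for an embedded submanifold
  \<open>S\<close> of \<open>M\<close> does not depend on the chosen extensions \<open>U\<close>, \<open>V\<close> of the tangent vectors
  \<open>u\<close>, \<open>v\<close>.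
\<close>

definition second_fundamental_form ::
  "'a::euclidean_space set \<Rightarrow> ('a \<Rightarrow> 'a \<Rightarrow> 'a \<Rightarrow> real) \<Rightarrow> 'a set \<Rightarrow> 'a \<Rightarrow> 'a \<Rightarrow> 'a \<Rightarrow> 'a" where
  "second_fundamental_form M g S p u v =
     normal_part M g S p
       (levi_civita M g (SOME U. tangential_extension M S p u U)
                        (SOME V. tangential_extension M S p v V) p)"

definition orthonormal_tangent_basis ::
  "('a::euclidean_space \<Rightarrow> 'a \<Rightarrow> 'a \<Rightarrow> real) \<Rightarrow> 'a set \<Rightarrow> 'a \<Rightarrow> 'a set \<Rightarrow> bool" where
  "orthonormal_tangent_basis g S p B \<longleftrightarrow>
     finite B \<and> span B = tangent_space S p \<and>
     (\<forall>b\<in>B. \<forall>b'\<in>B. g p b b' = (if b = b' then 1 else 0))"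

text \<open>
  The trace of the second fundamental form, not divided by the dimension of \<open>S\<close>; it does not
  depend on the chosen basis.
\<close>

definition mean_curvature ::
  "'a::euclidean_space set \<Rightarrow> ('a \<Rightarrow> 'a \<Rightarrow> 'a \<Rightarrow> real) \<Rightarrow> 'a set \<Rightarrow> 'a \<Rightarrow> 'a" where
  "mean_curvature M g S p =
     (\<Sum>b\<in>(SOME B. orthonormal_tangent_basis g S p B). second_fundamental_form M g S p b b)"

definition minimal_embedding ::
  "'b::euclidean_space set \<Rightarrow> 'a::euclidean_space set \<Rightarrow> ('a \<Rightarrow> 'a \<Rightarrow> 'a \<Rightarrow> real) \<Rightarrow>
   ('b \<Rightarrow> 'a) \<Rightarrow> bool" where
  "minimal_embedding N M g f \<longleftrightarrow>
     smooth_embedding N M f \<and> (\<forall>p \<in> f ` N. mean_curvature M g (f ` N) p = 0)"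


section \<open>The group \<open>SU(3)\<close> and the map \<open>\<eta>\<close>\<close>

definition conj_transpose :: "complex^'n^'m \<Rightarrow> complex^'m^'n" where
  "conj_transpose A = (\<chi> i j. cnj (A $ j $ i))"

definition SU3 :: "(complex^3^3) set" where
  "SU3 = {A. conj_transpose A ** A = mat 1 \<and> det A = 1}"

text \<open>
  Left and right translations are restrictions of linear maps, so their differentials are
  again left and right multiplication.
\<close>

definition bi_invariant_metric ::
  "(complex^3^3 \<Rightarrow> complex^3^3 \<Rightarrow> complex^3^3 \<Rightarrow> real) \<Rightarrow> bool" where
  "bi_invariant_metric g \<longleftrightarrow>
     riemannian_metric SU3 g \<and>
     (\<forall>h\<in>SU3. \<forall>p\<in>SU3. \<forall>u\<in>tangent_space SU3 p. \<forall>v\<in>tangent_space SU3 p.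
        g (h ** p) (h ** u) (h ** v) = g p u v \<and>
        g (p ** h) (u ** h) (v ** h) = g p u v)"

definition eta :: "complex^3 \<Rightarrow> complex^3^3" where
  "eta z = (\<chi> i j. z $ i * z $ j) +
     vector [vector [0, - cnj (z $ 3), cnj (z $ 2)],
             vector [cnj (z $ 3), 0, - cnj (z $ 1)],
             vector [- cnj (z $ 2), cnj (z $ 1), 0]]"

end

theory Submission
  imports Defs
begin

text \<open>
  The image \<open>S\<close> of \<open>\<eta>\<close> is an orbit of the isometric action \<open>(A, q) \<mapsto> A q A\<^sup>t\<close> of \<open>SU(3)\<close> on
  itself: since \<open>cnj A\<close> is the cofactor matrix of \<open>A\<close>, one has \<open>\<eta>(A z) = A \<eta>(z) A\<^sup>t\<close>
  (\<open>eta_equivariant\<close>), and \<open>SU(3)\<close> is transitive on the sphere (\<open>SU3_transitive\<close>). Hence the mean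
  curvature vector \<open>H\<close> at \<open>p = \<eta>(z)\<close> is fixed by the stabilizer of \<open>z\<close>, a copy of \<open>SU(2)\<close>. Under
  this group \<open>T\<^sub>p SU(3)\<close> splits as \<open>\<real> \<oplus> su(2) \<oplus> \<complex>\<^sup>2\<close>, where only the line \<open>\<real>\<close> is fixed, and this line is
  tangent to \<open>S\<close> (\<open>isotropy_fixed_tangent\<close>). So \<open>H\<close> is both normal and tangent and vanishes.

  To carry this out, the Levi-Civita connection has to be known. For vector fields on
  \<open>SU(3) \<subseteq> \<complex>\<^sup>3\<^sup>\<times>\<^sup>3\<close> it is \<open>\<nabla>\<^sub>X Y = dY(X) - (X p\<^sup>* Y + Y p\<^sup>* X)/2\<close>, the usual
  \<open>dy(X) + [x, y]/2\<close> of the left trivialization (\<open>is_levi_civita_SU3_connection\<close>); it is the only one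
  (\<open>levi_civita_unique\<close>). For fields tangent to \<open>S\<close> its value at \<open>p\<close> is, modulo \<open>T\<^sub>p S\<close>, an explicit
  bilinear expression in the values of the fields
  (\<open>connection_eq_eta_second_fundamental\<close>), which settles at once that the choice of the
  extensions is immaterial and that the trace over an orthonormal basis is independent of the
  basis. This bilinear expression is equivariant, so its trace is fixed by the stabilizer
  (\<open>trace_second_fundamental_isotropy_invariant\<close>).
\<close>

section \<open>Smooth maps\<close>

lemma Ck_on_subset: "Ck_on k U f \<Longrightarrow> V \<subseteq> U \<Longrightarrow> Ck_on k V f"
  by (induction k arbitrary: f) (auto intro: continuous_on_subset)

lemma Ck_on_cong:
  assumes "open U" "\<And>x. x \<in> U \<Longrightarrow> f x = g x" "Ck_on k U f"
  shows "Ck_on k U g"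
  using assms(2,3)
proof (induction k arbitrary: f g)
  case 0
  then show ?case by (simp cong: continuous_on_cong)
next
  case (Suc k)
  have d: "(g has_derivative frechet_derivative f (at x)) (at x)" if "x \<in> U" for x
    using Suc.prems that assms(1)
    by (auto intro: has_derivative_transform_within_open simp: frechet_derivative_works)
  have "g differentiable at x" if "x \<in> U" for x
    using d[OF that] by (auto simp: differentiable_def)
  moreover have "Ck_on k U (\<lambda>x. frechet_derivative g (at x) v)" for v
    by (rule Suc.IH[of "\<lambda>x. frechet_derivative f (at x) v"])
      (use Suc.prems frechet_derivative_at[OF d] in auto)
  ultimately show ?case by auto
qed

text \<open>
  Any pointwise derivative may serve in the recursion for \<open>Ck_on\<close>, so that the product and chain
  rules apply without computing Frechet derivatives explicitly.
\<close>

lemma Ck_on_Suc: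
  assumes "open U" "\<And>x. x \<in> U \<Longrightarrow> (f has_derivative D x) (at x)" "\<And>v. Ck_on k U (\<lambda>x. D x v)"
  shows "Ck_on (Suc k) U f"
proof -
  have "Ck_on k U (\<lambda>x. frechet_derivative f (at x) v)" for v
    by (rule Ck_on_cong[OF assms(1) _ assms(3)[of v]]) (use frechet_derivative_at[OF assms(2)] in auto)
  then show ?thesis using assms(2) by (auto simp: differentiable_def)
qed

lemma Ck_on_has_derivative:
  "Ck_on (Suc k) U f \<Longrightarrow> x \<in> U \<Longrightarrow> (f has_derivative frechet_derivative f (at x)) (at x)"
  by (simp add: frechet_derivative_works)

lemma Ck_on_SucD: "Ck_on (Suc k) U f \<Longrightarrow> Ck_on k U f"
proof (induction k arbitrary: f)
  case 0
  then have "f differentiable_on U"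
    by (simp add: differentiable_on_def differentiable_at_withinI)
  then show ?case
    by (simp add: differentiable_imp_continuous_on)
next
  case (Suc k)
  have "Ck_on k U (\<lambda>x. frechet_derivative f (at x) v)" for v
    using Suc.IH Suc.prems Ck_on.simps(2)[of "Suc k"] by blast
  then show ?case using Suc.prems Ck_on.simps(2) by blast
qed

lemma Ck_on_const: "Ck_on k U (\<lambda>x. c)"
  by (induction k arbitrary: c) auto

lemma Ck_on_linear:
  assumes "bounded_linear L" "open U" "Ck_on k U f"
  shows "Ck_on k U (\<lambda>x. L (f x))"
  using assms(3)
proof (induction k arbitrary: f)
  case 0
  then show ?case using bounded_linear.continuous_on[OF assms(1)] by auto
next
  case (Suc k)
  show ?case
    by (rule Ck_on_Suc[OF assms(2)
          bounded_linear.has_derivative[OF assms(1) Ck_on_has_derivative[OF Suc.prems]]])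
      (use Suc in auto)
qed

lemma Ck_on_add:
  assumes "open U" "Ck_on k U f" "Ck_on k U g"
  shows "Ck_on k U (\<lambda>x. f x + g x)"
  using assms(2,3)
proof (induction k arbitrary: f g)
  case 0
  then show ?case by (auto intro: continuous_on_add)
next
  case (Suc k)
  show ?case
    by (rule Ck_on_Suc[OF assms(1) has_derivative_add[OF Ck_on_has_derivative[OF Suc.prems(1)]
            Ck_on_has_derivative[OF Suc.prems(2)]]])
      (use Suc in auto)
qed

lemma Ck_on_sum:
  assumes "open U" "\<And>i. i \<in> I \<Longrightarrow> Ck_on k U (f i)"
  shows "Ck_on k U (\<lambda>x. \<Sum>i\<in>I. f i x)"
  using assms(2) by (induction I rule: infinite_finite_induct) (auto intro!: Ck_on_const Ck_on_add assms(1))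

lemma Ck_on_bilinear:
  assumes "bounded_bilinear h" "open U" "Ck_on k U f" "Ck_on k U g"
  shows "Ck_on k U (\<lambda>x. h (f x) (g x))"
  using assms(3,4)
proof (induction k arbitrary: f g)
  case 0
  then show ?case using bounded_bilinear.continuous_on[OF assms(1)] by auto
next
  case (Suc k)
  show ?case
  proof (rule Ck_on_Suc[OF assms(2) bounded_bilinear.FDERIV[OF assms(1)
            Ck_on_has_derivative[OF Suc.prems(1)] Ck_on_has_derivative[OF Suc.prems(2)]]])
    show "Ck_on k U (\<lambda>x. h (f x) (frechet_derivative g (at x) v)
        + h (frechet_derivative f (at x) v) (g x))" for v
      using Suc.IH Suc.prems Suc.prems[THEN Ck_on_SucD] by (intro Ck_on_add assms(2)) auto
  qed
qed

lemma smooth_on_open_const: "open U \<Longrightarrow> smooth_on_open U (\<lambda>x. c)"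
  by (simp add: smooth_on_open_def Ck_on_const)

lemma smooth_on_open_linear:
  "bounded_linear L \<Longrightarrow> smooth_on_open U f \<Longrightarrow> smooth_on_open U (\<lambda>x. L (f x))"
  by (simp add: smooth_on_open_def Ck_on_linear)

lemma smooth_on_open_add:
  "smooth_on_open U f \<Longrightarrow> smooth_on_open U g \<Longrightarrow> smooth_on_open U (\<lambda>x. f x + g x)"
  by (simp add: smooth_on_open_def Ck_on_add)

lemma smooth_on_open_bilinear:
  "bounded_bilinear h \<Longrightarrow> smooth_on_open U f \<Longrightarrow> smooth_on_open U g
    \<Longrightarrow> smooth_on_open U (\<lambda>x. h (f x) (g x))"
  by (simp add: smooth_on_open_def Ck_on_bilinear)

lemma smooth_on_open_subset:
  "smooth_on_open U f \<Longrightarrow> open V \<Longrightarrow> V \<subseteq> U \<Longrightarrow> smooth_on_open V f"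
  by (auto simp: smooth_on_open_def intro: Ck_on_subset)

lemma smooth_on_open_ident: "open U \<Longrightarrow> smooth_on_open U (\<lambda>x. x)"
proof -
  have "Ck_on k U (\<lambda>x. x)" if "open U" for k
    using that by (cases k) (auto simp: Ck_on_const)
  then show "open U \<Longrightarrow> smooth_on_open U (\<lambda>x. x)"
    by (simp add: smooth_on_open_def)
qed

lemma smooth_on_open_has_derivative:
  "smooth_on_open U f \<Longrightarrow> x \<in> U \<Longrightarrow> (f has_derivative frechet_derivative f (at x)) (at x)"
  using Ck_on_has_derivative[of 0 U f x] unfolding smooth_on_open_def by blast

text \<open>
  Smoothness of \<open>F\<close> controls \<open>dF\<^sub>p(v)\<close> for constant \<open>v\<close> only; expanding \<open>G p\<close> in an orthonormal basis
  reduces to this case. A covariant derivative is built from fields of this form.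
\<close>

lemma smooth_on_open_frechet_derivative:
  fixes F :: "'a::euclidean_space \<Rightarrow> 'b::real_normed_vector"
  assumes F: "smooth_on_open U F" and G: "smooth_on_open U G"
  shows "smooth_on_open U (\<lambda>x. frechet_derivative F (at x) (G x))"
proof -
  have U: "open U" using F by (simp add: smooth_on_open_def)
  have "Ck_on k U (\<lambda>x. frechet_derivative F (at x) (G x))" for k
  proof (rule Ck_on_cong[OF U])
    show "(\<Sum>b\<in>Basis. (G x \<bullet> b) *\<^sub>R frechet_derivative F (at x) b) = frechet_derivative F (at x) (G x)"
      if "x \<in> U" for x
    proof -
      have l: "linear (frechet_derivative F (at x))"
        using smooth_on_open_has_derivative[OF F that] has_derivative_linear by blast
      have "frechet_derivative F (at x) (G x)
          = frechet_derivative F (at x) (\<Sum>b\<in>Basis. (G x \<bullet> b) *\<^sub>R b)"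
        by (simp add: euclidean_representation)
      then show ?thesis by (simp add: linear_sum[OF l] linear_scale[OF l])
    qed
    have "Ck_on k U (\<lambda>x. frechet_derivative F (at x) b)" for b
      using F[unfolded smooth_on_open_def] Ck_on.simps(2) by blast
    moreover have "Ck_on k U (\<lambda>x. G x \<bullet> b)" for b
      using G by (intro Ck_on_linear[OF bounded_linear_inner_left U]) (auto simp: smooth_on_open_def)
    ultimately show "Ck_on k U (\<lambda>x. \<Sum>b\<in>Basis. (G x \<bullet> b) *\<^sub>R frechet_derivative F (at x) b)"
      by (intro Ck_on_sum[OF U] Ck_on_bilinear[OF bounded_bilinear_scaleR U])
  qed
  then show ?thesis using U by (simp add: smooth_on_open_def)
qed

text \<open>
  The derivative of a circle \<open>t \<mapsto> C + cos(at) A + sin(at) B\<close> is a curve of the same form, so circles are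
  smooth. Great circles and one-parameter subgroups are of this kind.
\<close>

lemma has_vector_derivative_circle:
  "((\<lambda>t. C + cos (a * t) *\<^sub>R A + sin (a * t) *\<^sub>R B) has_vector_derivative
     cos (a * t) *\<^sub>R (a *\<^sub>R B) + sin (a * t) *\<^sub>R ((- a) *\<^sub>R A)) (at t)"
  by (auto intro!: derivative_eq_intros simp: algebra_simps)

lemma smooth_on_open_circle:
  assumes "open U"
  shows "smooth_on_open U (\<lambda>t::real. C + cos (a * t) *\<^sub>R A + sin (a * t) *\<^sub>R B)"
proof -
  have "Ck_on k U (\<lambda>t::real. C + cos (a * t) *\<^sub>R A + sin (a * t) *\<^sub>R B)" for k
  proof (induction k arbitrary: A B C)
    case 0
    show ?case by (auto intro!: continuous_intros)
  next
    case (Suc k)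
    show ?case
    proof (rule Ck_on_Suc[OF assms has_vector_derivative_circle[unfolded has_vector_derivative_def]])
      fix v
      show "Ck_on k U (\<lambda>t. v *\<^sub>R (cos (a * t) *\<^sub>R (a *\<^sub>R B) + sin (a * t) *\<^sub>R ((- a) *\<^sub>R A)))"
        using Ck_on_linear[OF bounded_linear_scaleR_right assms Suc[of 0 "a *\<^sub>R B" "(- a) *\<^sub>R A"], of v]
        by simp
    qed
  qed
  with assms show ?thesis by (simp add: smooth_on_open_def)
qed


section \<open>Tangent vectors and differentials\<close>

definition smooth_curve_in :: "'a::euclidean_space set \<Rightarrow> (real \<Rightarrow> 'a) \<Rightarrow> real \<Rightarrow> 'a \<Rightarrow> 'a \<Rightarrow> bool" where
  "smooth_curve_in M c e p v \<longleftrightarrow> e > 0 \<and> smooth_on_open {-e<..<e} c \<and> c ` {-e<..<e} \<subseteq> M \<and>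
     c 0 = p \<and> (c has_vector_derivative v) (at 0)"

lemma tangent_space_iff: "v \<in> tangent_space M p \<longleftrightarrow> (\<exists>c e. smooth_curve_in M c e p v)"
  by (simp add: tangent_space_def smooth_curve_in_def)

lemma smooth_curve_in_vector_derivative:
  "smooth_curve_in M c e p v \<Longrightarrow> (c has_vector_derivative v) (at 0)"
  by (simp add: smooth_curve_in_def)

lemma smooth_curve_in_eventually:
  assumes "smooth_curve_in M c e p v"
  shows "\<forall>\<^sub>F t in nhds 0. c t \<in> M"
proof -
  have "\<forall>\<^sub>F t in nhds 0. t \<in> {-e<..<e}"
    using assms by (intro eventually_nhds_in_open) (auto simp: smooth_curve_in_def)
  then show ?thesis
    by eventually_elim (use assms in \<open>auto simp: smooth_curve_in_def\<close>)
qed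

text \<open>
  The form in which identities along curves are differentiated below: an identity that holds near 0
  passes to the derivatives at 0.
\<close>

lemma vector_derivative_eqI:
  assumes "(f has_vector_derivative a) (at (0::real))" "(g has_vector_derivative b) (at 0)"
    "\<forall>\<^sub>F t in nhds 0. f t = g t"
  shows "a = b"
proof -
  have "\<forall>\<^sub>F t in at 0. f t = g t" "f 0 = g 0"
    using assms(3) by (auto simp: eventually_at_filter elim: eventually_mono dest: eventually_nhds_x_imp_x)
  then have "(g has_vector_derivative a) (at 0)"
    using has_derivative_transform_eventually[OF assms(1)[unfolded has_vector_derivative_def]]
    by (simp add: has_vector_derivative_def)
  then show ?thesis
    using assms(2) vector_derivative_unique_at by blast
qed

lemma has_vector_derivative_along_curve:
  assumes c: "smooth_curve_in M c e p v" and f: "f differentiable (at p within M)"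
  shows "((\<lambda>t. f (c t)) has_vector_derivative differential M f p v) (at 0)"
proof -
  let ?I = "{-e<..<e}"
  have e: "e > 0" "c 0 = p" "c ` ?I \<subseteq> M" "(c has_vector_derivative v) (at 0)"
    using c by (auto simp: smooth_curve_in_def)
  have "(f has_derivative differential M f p) (at (c 0) within c ` ?I)"
    using f e by (auto simp: frechet_derivative_works intro: has_derivative_subset)
  from vector_derivative_diff_chain_within[OF has_vector_derivative_at_within[OF e(4)] this]
  have "((f \<circ> c) has_vector_derivative differential M f p v) (at 0 within ?I)" .
  then show ?thesis
    using e(1) at_within_open[of 0 ?I] by (simp add: o_def)
qed

lemma smooth_mapE:
  assumes "smooth_map M f" "p \<in> M"
  obtains U F where "p \<in> U" "smooth_on_open U F" "\<And>x. x \<in> M \<Longrightarrow> x \<in> U \<Longrightarrow> F x = f x"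
  using assms by (auto simp: smooth_map_def)

lemma smooth_map_differentiable:
  assumes "smooth_map M f" "p \<in> M"
  shows "f differentiable (at p within M)"
proof -
  obtain U F where U: "p \<in> U" "smooth_on_open U F" "\<And>x. x \<in> M \<Longrightarrow> x \<in> U \<Longrightarrow> F x = f x"
    using smooth_mapE[OF assms] by metis
  have "(F has_derivative frechet_derivative F (at p)) (at p within M)"
    using smooth_on_open_has_derivative[OF U(2,1)] has_derivative_at_withinI by blast
  moreover have "open U" using U(2) by (simp add: smooth_on_open_def)
  ultimately have "(f has_derivative frechet_derivative F (at p)) (at p within M)"
    using U assms(2)
    by (intro has_derivative_transform_eventually[of F _ p M f])
       (auto simp: eventually_at_filter intro!: eventually_mono[OF eventually_nhds_in_open[of U p]])
  then show ?thesis by (auto simp: differentiable_def)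
qed

text \<open>
  On tangent vectors the differential is computed along curves, which makes it independent of the
  choice hidden in the Frechet derivative within a set.
\<close>

lemma differential_eqI:
  assumes "smooth_curve_in M c e p v" "f differentiable (at p within M)"
    "((\<lambda>t. f (c t)) has_vector_derivative w) (at 0)"
  shows "differential M f p v = w"
  using has_vector_derivative_along_curve[OF assms(1,2)] assms(3) vector_derivative_unique_at by blast

lemma linear_differential: "f differentiable (at p within M) \<Longrightarrow> linear (differential M f p)"
  by (rule linear_frechet_derivative)

lemma differential_local_extension:
  assumes f: "smooth_map M f" and p: "p \<in> M" "p \<in> U" and F: "smooth_on_open U F"
    "\<And>x. x \<in> M \<Longrightarrow> x \<in> U \<Longrightarrow> F x = f x" and v: "v \<in> tangent_space M p"
  shows "differential M f p v = frechet_derivative F (at p) v"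
proof -
  obtain c e where c: "smooth_curve_in M c e p v" using v by (auto simp: tangent_space_iff)
  have c0: "c 0 = p" "(c has_vector_derivative v) (at 0)" using c by (auto simp: smooth_curve_in_def)
  have FU: "((\<lambda>t. F (c t)) has_vector_derivative frechet_derivative F (at p) v) (at 0)"
    using vector_derivative_diff_chain_within[of c v 0 UNIV F "frechet_derivative F (at p)"] c0
      smooth_on_open_has_derivative[OF F(1) p(2)] by (auto simp: o_def intro: has_derivative_at_withinI)
  have "open U" using F by (simp add: smooth_on_open_def)
  moreover have "(c \<longlongrightarrow> p) (nhds 0)"
    using has_vector_derivative_continuous[OF c0(2)] c0(1) by (simp add: continuous_at tendsto_nhds_iff)
  ultimately have "\<forall>\<^sub>F t in nhds 0. c t \<in> U"
    using p(2) by (auto dest: topological_tendstoD)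
  then have "\<forall>\<^sub>F t in nhds 0. f (c t) = F (c t)"
    using smooth_curve_in_eventually[OF c] by eventually_elim (simp add: F)
  from vector_derivative_eqI[OF has_vector_derivative_along_curve[OF c smooth_map_differentiable[OF f p(1)]] FU this]
  show ?thesis .
qed

lemma smooth_on_open_UNIV_imp_smooth_map:
  "smooth_on_open UNIV f \<Longrightarrow> smooth_map M f"
  unfolding smooth_map_def by (intro ballI exI[of _ UNIV] exI[of _ f]) auto

lemma smooth_map_differential:
  assumes Y: "smooth_map M Y" and X: "smooth_map M X" and T: "\<And>p. p \<in> M \<Longrightarrow> X p \<in> tangent_space M p"
  shows "smooth_map M (\<lambda>p. differential M Y p (X p))"
  unfolding smooth_map_def
proof
  fix p assume p: "p \<in> M"
  obtain U F where U: "p \<in> U" "smooth_on_open U F" "\<And>x. x \<in> M \<Longrightarrow> x \<in> U \<Longrightarrow> F x = Y x"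
    using smooth_mapE[OF Y p] by metis
  obtain V G where V: "p \<in> V" "smooth_on_open V G" "\<And>x. x \<in> M \<Longrightarrow> x \<in> V \<Longrightarrow> G x = X x"
    using smooth_mapE[OF X p] by metis
  have o: "open (U \<inter> V)" using U V by (auto simp: smooth_on_open_def)
  have F: "smooth_on_open (U \<inter> V) F" and G: "smooth_on_open (U \<inter> V) G"
    using smooth_on_open_subset[OF U(2) o] smooth_on_open_subset[OF V(2) o] by auto
  show "\<exists>W H. p \<in> W \<and> smooth_on_open W H \<and> (\<forall>x\<in>M \<inter> W. H x = differential M Y x (X x))"
    using smooth_on_open_frechet_derivative[OF F G] U V
      differential_local_extension[OF Y _ _ F _ T]
    by (intro exI[of _ "U \<inter> V"] exI[of _ "\<lambda>x. frechet_derivative F (at x) (G x)"]) auto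
qed

lemma smooth_map_bilinear:
  assumes h: "bounded_bilinear h" and f: "smooth_map M f" and g: "smooth_map M g"
  shows "smooth_map M (\<lambda>p. h (f p) (g p))"
  unfolding smooth_map_def
proof
  fix p assume p: "p \<in> M"
  obtain U F where U: "p \<in> U" "smooth_on_open U F" "\<And>x. x \<in> M \<Longrightarrow> x \<in> U \<Longrightarrow> F x = f x"
    using smooth_mapE[OF f p] by metis
  obtain V G where V: "p \<in> V" "smooth_on_open V G" "\<And>x. x \<in> M \<Longrightarrow> x \<in> V \<Longrightarrow> G x = g x"
    using smooth_mapE[OF g p] by metis
  have o: "open (U \<inter> V)" using U V by (auto simp: smooth_on_open_def)
  have "smooth_on_open (U \<inter> V) F" and "smooth_on_open (U \<inter> V) G"
    using smooth_on_open_subset[OF U(2) o] smooth_on_open_subset[OF V(2) o] by auto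
  from smooth_on_open_bilinear[OF h this] 
  show "\<exists>W H. p \<in> W \<and> smooth_on_open W H \<and> (\<forall>x\<in>M \<inter> W. H x = h (f x) (g x))"
    using U V by (intro exI[of _ "U \<inter> V"] exI[of _ "\<lambda>x. h (F x) (G x)"]) auto
qed

lemma smooth_map_linear:
  assumes h: "bounded_linear h" and f: "smooth_map M f"
  shows "smooth_map M (\<lambda>p. h (f p))"
  using smooth_on_open_linear[OF h] f unfolding smooth_map_def by (metis IntE)

lemma smooth_map_ident: "smooth_map M (\<lambda>p. p)"
  by (intro smooth_on_open_UNIV_imp_smooth_map smooth_on_open_ident) auto

lemma smooth_map_add:
  assumes f: "smooth_map M f" and g: "smooth_map M g"
  shows "smooth_map M (\<lambda>p. f p + g p)"
  unfolding smooth_map_def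
proof
  fix p assume p: "p \<in> M"
  obtain U F where U: "p \<in> U" "smooth_on_open U F" "\<And>x. x \<in> M \<Longrightarrow> x \<in> U \<Longrightarrow> F x = f x"
    using smooth_mapE[OF f p] by metis
  obtain V G where V: "p \<in> V" "smooth_on_open V G" "\<And>x. x \<in> M \<Longrightarrow> x \<in> V \<Longrightarrow> G x = g x"
    using smooth_mapE[OF g p] by metis
  have o: "open (U \<inter> V)" using U V by (auto simp: smooth_on_open_def)
  have "smooth_on_open (U \<inter> V) F" and "smooth_on_open (U \<inter> V) G"
    using smooth_on_open_subset[OF U(2) o] smooth_on_open_subset[OF V(2) o] by auto
  from smooth_on_open_add[OF this] 
  show "\<exists>W H. p \<in> W \<and> smooth_on_open W H \<and> (\<forall>x\<in>M \<inter> W. H x = f x + g x)"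
    using U V by (intro exI[of _ "U \<inter> V"] exI[of _ "\<lambda>x. F x + G x"]) auto
qed


section \<open>The group SU(3) and its Lie algebra\<close>

lemma bounded_bilinear_matrix_mult:
  "bounded_bilinear ((**) :: complex^'n^'m \<Rightarrow> complex^'k^'n \<Rightarrow> complex^'k^'m)"
proof -
  have "bilinear ((**) :: complex^'n^'m \<Rightarrow> complex^'k^'n \<Rightarrow> complex^'k^'m)"
    unfolding bilinear_def
    by (auto intro!: linearI simp: matrix_matrix_mult_def vec_eq_iff sum.distrib algebra_simps scaleR_sum_right)
  then show ?thesis by (simp add: bilinear_conv_bounded_bilinear)
qed

lemma bounded_linear_conj_transpose: "bounded_linear (conj_transpose :: complex^'n^'m \<Rightarrow> _)"
  by (auto intro!: linearI simp: conj_transpose_def vec_eq_iff simp flip: linear_conv_bounded_linear)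

lemma bounded_linear_trace: "bounded_linear (trace :: complex^'n^'n \<Rightarrow> complex)"
  by (auto intro!: linearI simp: trace_def sum.distrib scaleR_sum_right simp flip: linear_conv_bounded_linear)

lemma conj_transpose_mult: "conj_transpose (A ** B) = conj_transpose B ** conj_transpose A"
  by (simp add: conj_transpose_def matrix_matrix_mult_def vec_eq_iff mult.commute)

lemma conj_transpose_involution [simp]: "conj_transpose (conj_transpose A) = A"
  by (simp add: conj_transpose_def vec_eq_iff)

lemma conj_transpose_mat_1 [simp]: "conj_transpose (mat 1) = mat 1"
  by (auto simp: conj_transpose_def vec_eq_iff mat_def)

lemma conj_transpose_transpose: "conj_transpose (transpose A) = transpose (conj_transpose A)"
  by (simp add: conj_transpose_def transpose_def)

lemmas conj_transpose_linear_simps =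
  linear_add[OF bounded_linear.linear[OF bounded_linear_conj_transpose]]
  linear_diff[OF bounded_linear.linear[OF bounded_linear_conj_transpose]]
  linear_neg[OF bounded_linear.linear[OF bounded_linear_conj_transpose]]
  linear_scale[OF bounded_linear.linear[OF bounded_linear_conj_transpose]]

lemmas matrix_mult_simps =
  bounded_bilinear.add_left[OF bounded_bilinear_matrix_mult]
  bounded_bilinear.add_right[OF bounded_bilinear_matrix_mult]
  bounded_bilinear.diff_left[OF bounded_bilinear_matrix_mult]
  bounded_bilinear.diff_right[OF bounded_bilinear_matrix_mult]
  bounded_bilinear.minus_left[OF bounded_bilinear_matrix_mult]
  bounded_bilinear.minus_right[OF bounded_bilinear_matrix_mult]
  bounded_bilinear.scaleR_left[OF bounded_bilinear_matrix_mult]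
  bounded_bilinear.scaleR_right[OF bounded_bilinear_matrix_mult]

lemma SU3_left_inverse: "A \<in> SU3 \<Longrightarrow> conj_transpose A ** A = mat 1"
  by (simp add: SU3_def)

lemma SU3_right_inverse: "A \<in> SU3 \<Longrightarrow> A ** conj_transpose A = mat 1"
  using SU3_left_inverse matrix_left_right_inverse by blast

lemma SU3_cancel_right: "A \<in> SU3 \<Longrightarrow> B ** A ** conj_transpose A = B"
  using SU3_right_inverse by (metis matrix_mul_assoc matrix_mul_rid)

lemma SU3_one: "mat 1 \<in> SU3"
  by (simp add: SU3_def)

lemma SU3_mult: "A \<in> SU3 \<Longrightarrow> B \<in> SU3 \<Longrightarrow> A ** B \<in> SU3"
  by (auto simp: SU3_def det_mul conj_transpose_mult) (metis matrix_mul_assoc matrix_mul_lid)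

lemma SU3_conj_transpose:
  assumes "A \<in> SU3" shows "conj_transpose A \<in> SU3"
proof -
  have "det (conj_transpose A) = cnj (det A)"
    by (simp add: det_3 conj_transpose_def)
  then show ?thesis using SU3_right_inverse[OF assms] assms by (simp add: SU3_def)
qed

lemma SU3_transpose:
  assumes "A \<in> SU3" shows "transpose A \<in> SU3"
proof -
  have "transpose (A ** conj_transpose A) = mat 1"
    by (simp add: SU3_right_inverse[OF assms])
  then show ?thesis
    using assms by (simp add: SU3_def matrix_transpose_mul conj_transpose_transpose)
qed

definition su3 :: "(complex^3^3) set" where
  "su3 = {X. conj_transpose X = - X \<and> trace X = 0}"

lemma subspace_su3: "subspace su3"
  using linear_0[OF bounded_linear.linear[OF bounded_linear_conj_transpose]]
  by (auto simp: su3_def subspace_def conj_transpose_linear_simps trace_add linear_0[OF bounded_linear.linear[OF bounded_linear_trace]]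
      linear_scale[OF bounded_linear.linear[OF bounded_linear_trace]])

lemma su3_Ad:
  assumes "A \<in> SU3" "X \<in> su3"
  shows "A ** X ** conj_transpose A \<in> su3"
proof -
  have "trace (A ** X ** conj_transpose A) = trace X"
    by (metis SU3_cancel_right[OF SU3_conj_transpose[OF assms(1)]] SU3_left_inverse[OF assms(1)]
        conj_transpose_involution matrix_mul_assoc matrix_mul_lid trace_mul_sym)
  then show ?thesis
    using assms(2) by (simp add: su3_def conj_transpose_mult matrix_mult_simps matrix_mul_assoc)
qed

lemma su3_bracket:
  assumes "X \<in> su3" "Y \<in> su3"
  shows "X ** Y - Y ** X \<in> su3"
  using assms by (auto simp: su3_def conj_transpose_mult conj_transpose_linear_simps matrix_mult_simps
      linear_diff[OF bounded_linear.linear[OF bounded_linear_trace]] trace_mul_sym[of X Y])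

lemma has_vector_derivative_det:
  fixes c :: "real \<Rightarrow> complex^3^3"
  assumes c: "(c has_vector_derivative v) (at 0)" and "c 0 = mat 1"
  shows "((\<lambda>t. det (c t)) has_vector_derivative trace v) (at 0)"
proof -
  have [derivative_intros]: "((\<lambda>t. c t $ i $ j) has_vector_derivative v $ i $ j) (at 0)" for i j
    using bounded_linear.has_vector_derivative[OF bounded_linear_vec_nth
        bounded_linear.has_vector_derivative[OF bounded_linear_vec_nth c]] .
  show ?thesis
    unfolding det_3 trace_def sum_3
    by (rule has_vector_derivative_eq_rhs, (rule derivative_intros)+) (simp add: assms(2) mat_def)
qed

text \<open>Differentiate \<open>b b\<^sup>* = 1\<close> and \<open>det b = 1\<close> along the translated curve \<open>b = p\<^sup>* c\<close> through the identity.\<close>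

lemma tangent_space_SU3_imp_su3:
  assumes "v \<in> tangent_space SU3 p"
  shows "p \<in> SU3" "conj_transpose p ** v \<in> su3"
proof -
  obtain c e where c: "smooth_curve_in SU3 c e p v"
    using assms by (auto simp: tangent_space_iff)
  have c0: "c 0 = p" and cv: "(c has_vector_derivative v) (at 0)"
    using c by (auto simp: smooth_curve_in_def)
  show p: "p \<in> SU3" using c by (force simp: smooth_curve_in_def)
  let ?b = "\<lambda>t. conj_transpose p ** c t"
  have b: "(?b has_vector_derivative conj_transpose p ** v) (at 0)"
    by (rule bounded_linear.has_vector_derivative[OF
          bounded_bilinear.bounded_linear_right[OF bounded_bilinear_matrix_mult] cv])
  have b0: "?b 0 = mat 1" by (simp add: c0 SU3_left_inverse p)
  have bSU: "\<forall>\<^sub>F t in nhds 0. ?b t \<in> SU3"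
    using smooth_curve_in_eventually[OF c]
    by eventually_elim (simp add: SU3_mult SU3_conj_transpose p)
  have "trace (conj_transpose p ** v) = 0"
    by (rule vector_derivative_eqI[OF has_vector_derivative_det[OF b b0] has_vector_derivative_const[of 1]])
      (use bSU in eventually_elim, simp add: SU3_def)
  moreover have "?b 0 ** conj_transpose (conj_transpose p ** v) + (conj_transpose p ** v) ** conj_transpose (?b 0) = 0"
  proof (rule vector_derivative_eqI)
    show "((\<lambda>t. ?b t ** conj_transpose (?b t)) has_vector_derivative
      ?b 0 ** conj_transpose (conj_transpose p ** v) + (conj_transpose p ** v) ** conj_transpose (?b 0)) (at 0)"
      by (rule bounded_bilinear.has_vector_derivative[OF bounded_bilinear_matrix_mult b
            bounded_linear.has_vector_derivative[OF bounded_linear_conj_transpose b]])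
    show "((\<lambda>t. mat 1) has_vector_derivative 0) (at 0)" by (rule has_vector_derivative_const)
    show "\<forall>\<^sub>F t in nhds 0. ?b t ** conj_transpose (?b t) = mat 1"
      using bSU by eventually_elim (rule SU3_right_inverse)
  qed
  ultimately show "conj_transpose p ** v \<in> su3"
    by (simp add: su3_def b0 eq_neg_iff_add_eq_0)
qed

lemma smooth_curve_in_mult:
  assumes "smooth_curve_in SU3 c e p v" "smooth_curve_in SU3 c' e' q w"
  shows "smooth_curve_in SU3 (\<lambda>t. c t ** c' t) (min e e') (p ** q) (p ** w + v ** q)"
  unfolding smooth_curve_in_def
proof (intro conjI)
  have "smooth_on_open {-e<..<e} c" "smooth_on_open {-e'<..<e'} c'"
    using assms by (auto simp: smooth_curve_in_def)
  then have "smooth_on_open {- min e e'<..<min e e'} c" "smooth_on_open {- min e e'<..<min e e'} c'"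
    by (auto elim!: smooth_on_open_subset)
  then show "smooth_on_open {- min e e'<..<min e e'} (\<lambda>t. c t ** c' t)"
    by (rule smooth_on_open_bilinear[OF bounded_bilinear_matrix_mult])
  show "((\<lambda>t. c t ** c' t) has_vector_derivative p ** w + v ** q) (at 0)"
    using bounded_bilinear.has_vector_derivative[OF bounded_bilinear_matrix_mult
        smooth_curve_in_vector_derivative[OF assms(1)] smooth_curve_in_vector_derivative[OF assms(2)]]
    using assms by (simp add: smooth_curve_in_def)
  have "c t \<in> SU3 \<and> c' t \<in> SU3" if "t \<in> {- min e e'<..<min e e'}" for t
    using assms that by (auto simp: smooth_curve_in_def image_subset_iff min_def split: if_splits)
  then show "(\<lambda>t. c t ** c' t) ` {- min e e'<..<min e e'} \<subseteq> SU3"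
    by (blast intro: SU3_mult)
qed (use assms in \<open>auto simp: smooth_curve_in_def\<close>)

text \<open>
  The product rule for products of curves. It shows that tangent spaces are closed under addition
  (at the identity) and under translations.
\<close>

lemma tangent_space_SU3_mult:
  assumes "v \<in> tangent_space SU3 p" "w \<in> tangent_space SU3 q"
  shows "p ** w + v ** q \<in> tangent_space SU3 (p ** q)"
  using assms smooth_curve_in_mult unfolding tangent_space_iff by blast

lemma tangent_space_zero:
  assumes "p \<in> M" shows "0 \<in> tangent_space M p"
  unfolding tangent_space_iff smooth_curve_in_def using assms
  by (intro exI[of _ "\<lambda>_. p"] exI[of _ 1]) (auto intro: smooth_on_open_const)

text \<open>
  If \<open>C + D = 1\<close> splits the identity into coordinate projections and \<open>Y\<^sup>2 = - D\<close>, then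
  \<open>C + cos s D + sin s Y\<close> is the one-parameter group \<open>exp(s Y)\<close>. Here \<open>s = r t\<close> and \<open>Y = X / r\<close>, so that
  the velocity is \<open>X\<close>. For \<open>r = 0\<close> the quotient is 0, the right value because then \<open>X = 0\<close>.
\<close>

lemma su2_block_tangent:
  fixes C D X :: "complex^3^3"
  assumes SU: "\<And>t. C + cos (r * t) *\<^sub>R D + sin (r * t) *\<^sub>R (X /\<^sub>R r) \<in> SU3"
    and CD: "C + D = mat 1" and r: "r = 0 \<Longrightarrow> X = 0"
  shows "X \<in> tangent_space SU3 (mat 1)"
  unfolding tangent_space_iff smooth_curve_in_def
proof (intro exI conjI)
  let ?c = "\<lambda>t. C + cos (r * t) *\<^sub>R D + sin (r * t) *\<^sub>R (X /\<^sub>R r)"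
  show "smooth_on_open {-1<..<1} ?c" by (rule smooth_on_open_circle) simp
  have "r *\<^sub>R (X /\<^sub>R r) = X" using r by (cases "r = 0") auto
  then show "(?c has_vector_derivative X) (at 0)"
    using has_vector_derivative_circle[of C r D "X /\<^sub>R r" 0] by simp
qed (use SU CD in auto)

text \<open>
  The three coordinate copies of \<open>su(2)\<close>, which together span \<open>su(3)\<close>. A traceless skew-Hermitian
  \<open>2 \<times> 2\<close> matrix squares to \<open>- r\<^sup>2\<close>, where \<open>r\<^sup>2\<close> is its determinant; its one-parameter group
  consists of the matrices \<open>(u, - cnj v; v, cnj u)\<close> of \<open>SU(2)\<close>.
\<close>

lemma su3_block:
  fixes s :: real and w :: complex
  defines "X12 \<equiv> vector [vector [\<i> * s, - cnj w, 0], vector [w, - \<i> * s, 0], vector [0, 0, 0]] :: complex^3^3"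
    and "X13 \<equiv> vector [vector [\<i> * s, 0, - cnj w], vector [0, 0, 0], vector [w, 0, - \<i> * s]] :: complex^3^3"
    and "X23 \<equiv> vector [vector [0, 0, 0], vector [0, \<i> * s, - cnj w], vector [0, w, - \<i> * s]] :: complex^3^3"
  shows "X12 \<in> tangent_space SU3 (mat 1)" "X13 \<in> tangent_space SU3 (mat 1)"
    "X23 \<in> tangent_space SU3 (mat 1)"
proof -
  define r where "r = sqrt (s\<^sup>2 + (cmod w)\<^sup>2)"
  have r0: "s = 0 \<and> w = 0" if "r = 0"
    using that by (simp add: r_def sum_power2_eq_zero_iff)
  have rr: "complex_of_real s * complex_of_real s + w * cnj w = complex_of_real r * complex_of_real r"
  proof -
    have "r * r = s * s + (cmod w)\<^sup>2" by (simp add: r_def flip: power2_eq_square)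
    from arg_cong[OF this, of complex_of_real] show ?thesis
      by (simp add: complex_norm_square del: of_real_power)
  qed
  define u v where "u t = complex_of_real (cos (r * t)) + \<i> * (sin (r * t) * (s / r))"
    and "v t = sin (r * t) * (w / r)" for t
  have uv: "u t * cnj (u t) + v t * cnj (v t) = 1" for t
  proof (cases "r = 0")
    case False
    have cs: "complex_of_real (cos (r * t)) * cos (r * t) + complex_of_real (sin (r * t)) * sin (r * t) = 1"
      by (metis of_real_1 of_real_add of_real_mult power2_eq_square sin_cos_squared_add2)
    define C S :: complex where "C = cos (r * t)" and "S = sin (r * t)"
    have ur: "u t * r = C * r + \<i> * S * s" and vr: "v t * r = S * w"
      using False by (simp_all add: u_def v_def C_def S_def distrib_right)
    have real: "cnj C = C" "cnj S = S" by (simp_all add: C_def S_def)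
    have "(u t * cnj (u t) + v t * cnj (v t)) * (complex_of_real r * r)
        = (u t * r) * cnj (u t * r) + (v t * r) * cnj (v t * r)"
      by (simp add: algebra_simps)
    also have "\<dots> = C * C * (complex_of_real r * r) + S * S * (complex_of_real s * s + w * cnj w)"
      unfolding ur vr by (simp add: real algebra_simps)
    also have "\<dots> = (C * C + S * S) * (complex_of_real r * r)"
      unfolding rr by (simp add: algebra_simps)
    also have "C * C + S * S = 1" using cs by (simp add: C_def S_def)
    finally show ?thesis using False by simp
  qed (simp add: u_def v_def)
  have uv': "cnj (u t) * u t + cnj (v t) * v t = 1" for t
    using uv[of t] by (simp add: mult.commute)
  note defs = SU3_def conj_transpose_def matrix_matrix_mult_def vec_eq_iff forall_3 sum_3 det_3 mat_def
  show "X12 \<in> tangent_space SU3 (mat 1)"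
  proof (rule su2_block_tangent[of "vector [0, 0, vector [0, 0, 1]]" r "vector [vector [1, 0, 0], vector [0, 1, 0], 0]"])
    fix t
    have "vector [0, 0, vector [0, 0, 1]] + cos (r * t) *\<^sub>R vector [vector [1, 0, 0], vector [0, 1, 0], 0]
       + sin (r * t) *\<^sub>R (X12 /\<^sub>R r)
      = vector [vector [u t, - cnj (v t), 0], vector [v t, cnj (u t), 0], vector [0, 0, 1]]"
      by (simp add: X12_def vec_eq_iff forall_3 u_def v_def) (simp add: scaleR_conv_of_real field_simps)
    moreover have "\<dots> \<in> SU3" using uv[of t] uv'[of t] by (simp add: defs algebra_simps)
    ultimately show "vector [0, 0, vector [0, 0, 1]] + cos (r * t) *\<^sub>R vector [vector [1, 0, 0], vector [0, 1, 0], 0]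
       + sin (r * t) *\<^sub>R (X12 /\<^sub>R r) \<in> SU3" by (simp only:)
  qed (use r0 in \<open>simp_all add: X12_def vec_eq_iff forall_3 mat_def\<close>)
  show "X13 \<in> tangent_space SU3 (mat 1)"
  proof (rule su2_block_tangent[of "vector [0, vector [0, 1, 0], 0]" r "vector [vector [1, 0, 0], 0, vector [0, 0, 1]]"])
    fix t
    have "vector [0, vector [0, 1, 0], 0] + cos (r * t) *\<^sub>R vector [vector [1, 0, 0], 0, vector [0, 0, 1]]
       + sin (r * t) *\<^sub>R (X13 /\<^sub>R r)
      = vector [vector [u t, 0, - cnj (v t)], vector [0, 1, 0], vector [v t, 0, cnj (u t)]]"
      by (simp add: X13_def vec_eq_iff forall_3 u_def v_def) (simp add: scaleR_conv_of_real field_simps)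
    moreover have "\<dots> \<in> SU3" using uv[of t] uv'[of t] by (simp add: defs algebra_simps)
    ultimately show "vector [0, vector [0, 1, 0], 0] + cos (r * t) *\<^sub>R vector [vector [1, 0, 0], 0, vector [0, 0, 1]]
       + sin (r * t) *\<^sub>R (X13 /\<^sub>R r) \<in> SU3" by (simp only:)
  qed (use r0 in \<open>simp_all add: X13_def vec_eq_iff forall_3 mat_def\<close>)
  show "X23 \<in> tangent_space SU3 (mat 1)"
  proof (rule su2_block_tangent[of "vector [vector [1, 0, 0], 0, 0]" r "vector [0, vector [0, 1, 0], vector [0, 0, 1]]"])
    fix t
    have "vector [vector [1, 0, 0], 0, 0] + cos (r * t) *\<^sub>R vector [0, vector [0, 1, 0], vector [0, 0, 1]]
       + sin (r * t) *\<^sub>R (X23 /\<^sub>R r)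
      = vector [vector [1, 0, 0], vector [0, u t, - cnj (v t)], vector [0, v t, cnj (u t)]]"
      by (simp add: X23_def vec_eq_iff forall_3 u_def v_def) (simp add: scaleR_conv_of_real field_simps)
    moreover have "\<dots> \<in> SU3" using uv[of t] uv'[of t] by (simp add: defs algebra_simps)
    ultimately show "vector [vector [1, 0, 0], 0, 0] + cos (r * t) *\<^sub>R vector [0, vector [0, 1, 0], vector [0, 0, 1]]
       + sin (r * t) *\<^sub>R (X23 /\<^sub>R r) \<in> SU3" by (simp only:)
  qed (use r0 in \<open>simp_all add: X23_def vec_eq_iff forall_3 mat_def\<close>)
qed

lemma tangent_space_SU3_one: "tangent_space SU3 (mat 1) = su3"
proof
  show "tangent_space SU3 (mat 1) \<subseteq> su3"
    using tangent_space_SU3_imp_su3(2)[of _ "mat 1"] by auto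
  show "su3 \<subseteq> tangent_space SU3 (mat 1)"
  proof
    fix X assume X: "X \<in> su3"
    define w12 w13 w23 where "w12 = X $ 2 $ 1" and "w13 = X $ 3 $ 1" and "w23 = X $ 3 $ 2"
    \<comment> \<open>The off-diagonal entries are distributed over the three blocks; two blocks carry the traceless diagonal.\<close>
    define s12 s13 where "s12 = - Im (X $ 2 $ 2)" and "s13 = - Im (X $ 3 $ 3)"
    have skew: "cnj (X $ j $ i) = - X $ i $ j" for i j
      using X by (auto simp: su3_def conj_transpose_def vec_eq_iff)
    have re: "Re (X $ i $ i) = 0" for i
      using skew[of i i] by (simp add: complex_eq_iff)
    have tr: "X $ 1 $ 1 = - X $ 2 $ 2 - X $ 3 $ 3"
      using X by (simp add: su3_def trace_def sum_3 algebra_simps eq_neg_iff_add_eq_0)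
    have diag: "\<i> * s12 = - X $ 2 $ 2" "\<i> * s13 = - X $ 3 $ 3"
      by (simp_all add: complex_eq_iff re s12_def s13_def)
    have X12: "vector [vector [\<i> * s12, - cnj w12, 0], vector [w12, - \<i> * s12, 0], vector [0, 0, 0]] \<in> tangent_space SU3 (mat 1)"
      and X13: "vector [vector [\<i> * s13, 0, - cnj w13], vector [0, 0, 0], vector [w13, 0, - \<i> * s13]] \<in> tangent_space SU3 (mat 1)"
      and X23: "vector [vector [0, 0, 0], vector [0, \<i> * (0::real), - cnj w23], vector [0, w23, - \<i> * (0::real)]] \<in> tangent_space SU3 (mat 1)"
      by (rule su3_block)+
    have "X = (vector [vector [\<i> * s12, - cnj w12, 0], vector [w12, - \<i> * s12, 0], vector [0, 0, 0]]
        + vector [vector [\<i> * s13, 0, - cnj w13], vector [0, 0, 0], vector [w13, 0, - \<i> * s13]])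
        + vector [vector [0, 0, 0], vector [0, \<i> * (0::real), - cnj w23], vector [0, w23, - \<i> * (0::real)]]"
      unfolding vec_eq_iff forall_3 by (simp add: w12_def w13_def w23_def skew diag tr)
    moreover have add: "x + y \<in> tangent_space SU3 (mat 1)"
      if "x \<in> tangent_space SU3 (mat 1)" "y \<in> tangent_space SU3 (mat 1)" for x y
      using tangent_space_SU3_mult[OF that(2,1)] by simp
    ultimately show "X \<in> tangent_space SU3 (mat 1)"
      using X12 X13 X23 by (metis add)
  qed
qed

lemma tangent_space_SU3_iff:
  assumes "p \<in> SU3"
  shows "v \<in> tangent_space SU3 p \<longleftrightarrow> conj_transpose p ** v \<in> su3"
proof
  assume "conj_transpose p ** v \<in> su3"
  then have "p ** (conj_transpose p ** v) + 0 ** mat 1 \<in> tangent_space SU3 (p ** mat 1)"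
    by (intro tangent_space_SU3_mult tangent_space_zero assms) (simp add: tangent_space_SU3_one)
  moreover have "p ** (conj_transpose p ** v) = v"
    by (simp add: matrix_mul_assoc SU3_right_inverse assms)
  moreover have "(0::complex^3^3) ** mat 1 = 0"
    by (simp add: matrix_mul_rid)
  ultimately show "v \<in> tangent_space SU3 p" by simp
qed (rule tangent_space_SU3_imp_su3)


section \<open>The Levi-Civita connection of a bi-invariant metric\<close>

lemma riemannian_metric_diff_left:
  assumes "riemannian_metric M g" "subspace (tangent_space M p)" "p \<in> M"
    "u \<in> tangent_space M p" "v \<in> tangent_space M p" "w \<in> tangent_space M p"
  shows "g p (u - v) w = g p u w - g p v w"
proof -
  have "g p ((-1) *\<^sub>R v + u) w = (-1) * g p v w + g p u w"
    using assms unfolding riemannian_metric_def by blast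
  then show ?thesis by simp
qed

lemma is_levi_civitaD:
  assumes "is_levi_civita M g nabla" "X \<in> vector_fields M" "Y \<in> vector_fields M"
  shows "nabla X Y \<in> vector_fields M"
    "p \<in> M \<Longrightarrow> nabla X Y p - nabla Y X p = lie_bracket M X Y p"
    "Z \<in> vector_fields M \<Longrightarrow> p \<in> M \<Longrightarrow>
      differential M (\<lambda>q. g q (Y q) (Z q)) p (X p) = g p (nabla X Y p) (Z p) + g p (Y p) (nabla X Z p)"
  using assms(1)[unfolded is_levi_civita_def, THEN conjunct1]
    assms(1)[unfolded is_levi_civita_def, THEN conjunct2, THEN conjunct2, THEN conjunct2, THEN conjunct1]
    assms(1)[unfolded is_levi_civita_def, THEN conjunct2, THEN conjunct2, THEN conjunct2, THEN conjunct2]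
    assms(2,3)
  by blast+

text \<open>
  The difference \<open>A\<close> of two Levi-Civita connections satisfies \<open>g(A(X,Y),Z) = g(A(Y,X),Z)\<close>, as both are
  torsion free, and \<open>g(A(X,Y),Z) = - g(A(X,Z),Y)\<close>, as both are metric; six alternating swaps show that
  it vanishes, since covariant derivatives are themselves vector fields and \<open>Z\<close> may be either of them.
\<close>

lemma levi_civita_unique:
  assumes g: "riemannian_metric M g" and sub: "subspace (tangent_space M p)" and p: "p \<in> M"
    and n: "is_levi_civita M g n1" "is_levi_civita M g n2"
    and XY: "X \<in> vector_fields M" "Y \<in> vector_fields M"
  shows "n1 X Y p = n2 X Y p"
proof -
  let ?V = "vector_fields M" and ?T = "tangent_space M p"
  define a where "a X Y Z = g p (n1 X Y p - n2 X Y p) (Z p)" for X Y Z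
  have sym: "g p u v = g p v u" if "u \<in> ?T" "v \<in> ?T" for u v
    using g p that unfolding riemannian_metric_def by blast
  have vT: "X p \<in> ?T" if "X \<in> ?V" for X using that p by (simp add: vector_fields_def)
  have nV: "n1 X Y \<in> ?V" "n2 X Y \<in> ?V" if "X \<in> ?V" "Y \<in> ?V" for X Y
    using is_levi_civitaD(1)[OF n(1) that] is_levi_civitaD(1)[OF n(2) that] by auto
  note diff = riemannian_metric_diff_left[OF g sub p]
  have a_diff: "a X Y Z = g p (n1 X Y p) (Z p) - g p (n2 X Y p) (Z p)"
    if "X \<in> ?V" "Y \<in> ?V" "Z \<in> ?V" for X Y Z
    unfolding a_def using that by (intro diff vT nV)
  have swap12: "a X Y Z = a Y X Z" if "X \<in> ?V" "Y \<in> ?V" for X Y Z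
  proof -
    have "n1 X Y p - n1 Y X p = n2 X Y p - n2 Y X p"
      using is_levi_civitaD(2)[OF n(1) that p] is_levi_civitaD(2)[OF n(2) that p] by simp
    then have "n1 X Y p - n2 X Y p = n1 Y X p - n2 Y X p" by (simp add: algebra_simps)
    then show ?thesis by (simp add: a_def)
  qed
  have swap23: "a X Y Z = - a X Z Y" if V: "X \<in> ?V" "Y \<in> ?V" "Z \<in> ?V" for X Y Z
  proof -
    have "g p (n1 X Y p) (Z p) + g p (Y p) (n1 X Z p) = g p (n2 X Y p) (Z p) + g p (Y p) (n2 X Z p)"
      using is_levi_civitaD(3)[OF n(1) V p] is_levi_civitaD(3)[OF n(2) V p] by simp
    moreover have "g p (Y p) (n1 X Z p) = g p (n1 X Z p) (Y p)" "g p (Y p) (n2 X Z p) = g p (n2 X Z p) (Y p)"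
      using V by (auto intro!: sym vT nV)
    ultimately show ?thesis using V by (simp add: a_diff)
  qed
  have zero: "a X Y Z = 0" if V: "X \<in> ?V" "Y \<in> ?V" "Z \<in> ?V" for X Y Z
    using swap23[OF V] swap12[of X Z Y] swap23[of Z X Y] swap12[of Z Y X] swap23[of Y Z X]
      swap12[of X Y Z] V by linarith
  let ?d = "n1 X Y p - n2 X Y p"
  have dT: "?d \<in> ?T" using sub XY by (intro subspace_diff vT nV)
  have "g p ?d ?d = g p (n1 X Y p) ?d - g p (n2 X Y p) ?d"
    using XY by (intro diff[OF vT[OF nV(1)] vT[OF nV(2)] dT])
  also have "\<dots> = a X Y (n1 X Y) - a X Y (n2 X Y)"
    unfolding a_def using sym[OF vT[OF nV(1)[OF XY]] dT] sym[OF vT[OF nV(2)[OF XY]] dT] by simp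
  also have "\<dots> = 0" using XY by (simp add: zero nV)
  finally have "g p ?d ?d = 0" .
  then have "?d = 0"
    using g p dT unfolding riemannian_metric_def by (metis less_irrefl)
  then show ?thesis by simp
qed

lemma vector_derivative_linear_zero:
  assumes "bounded_linear L" "(y has_vector_derivative y') (at (0::real))" "\<forall>\<^sub>F t in nhds 0. L (y t) = 0"
  shows "L y' = 0"
  by (rule vector_derivative_eqI[OF bounded_linear.has_vector_derivative[OF assms(1,2)]
        has_vector_derivative_const assms(3)])

lemma su3_derivative:
  assumes y: "(y has_vector_derivative y') (at 0)" and su: "\<forall>\<^sub>F t in nhds 0. y t \<in> su3"
  shows "y' \<in> su3"
proof -
  have "trace y' = 0"
    by (rule vector_derivative_linear_zero[OF bounded_linear_trace y])
      (use su in eventually_elim, simp add: su3_def)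
  moreover have "conj_transpose y' + y' = 0"
    by (rule vector_derivative_linear_zero[OF
          bounded_linear_add[OF bounded_linear_conj_transpose bounded_linear_ident] y])
      (use su in eventually_elim, simp add: su3_def)
  ultimately show ?thesis by (simp add: su3_def eq_neg_iff_add_eq_0)
qed

lemma subspace_tangent_space_SU3:
  assumes "p \<in> SU3" shows "subspace (tangent_space SU3 p)"
  using subspace_su3 unfolding subspace_def
  by (auto simp: tangent_space_SU3_iff[OF assms] matrix_mult_simps
      bounded_bilinear.zero_right[OF bounded_bilinear_matrix_mult])

lemma tangent_space_SU3_translate:
  assumes "h \<in> SU3" "v \<in> tangent_space SU3 p"
  shows "h ** v \<in> tangent_space SU3 (h ** p)" "v ** h \<in> tangent_space SU3 (p ** h)"
  using tangent_space_SU3_mult[OF tangent_space_zero[OF assms(1)] assms(2)]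
    tangent_space_SU3_mult[OF assms(2) tangent_space_zero[OF assms(1)]]
  by (simp_all add: bounded_bilinear.zero_right[OF bounded_bilinear_matrix_mult]
      bounded_bilinear.zero_left[OF bounded_bilinear_matrix_mult])

text \<open>The skew-Hermitian part, made traceless.\<close>

definition su3_projection :: "complex^3^3 \<Rightarrow> complex^3^3" where
  "su3_projection A = (1/2) *\<^sub>R (A - conj_transpose A) - mat (trace ((1/2) *\<^sub>R (A - conj_transpose A)) / 3)"

lemma su3_projection_in: "su3_projection A \<in> su3"
  unfolding su3_projection_def su3_def
  by (simp add: vec_eq_iff forall_3 mat_def conj_transpose_def trace_def sum_3 complex_eq_iff)
    (simp add: field_simps)

lemma su3_projection_id: "X \<in> su3 \<Longrightarrow> su3_projection X = X"
proof -
  assume X: "X \<in> su3"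
  then have "(1/2) *\<^sub>R (X - conj_transpose X) = X"
    by (simp add: su3_def flip: scaleR_2)
  moreover have "mat (trace X / 3) = (0 :: complex^3^3)" using X by (simp add: su3_def mat_def vec_eq_iff)
  ultimately show "su3_projection X = X" by (simp add: su3_projection_def)
qed

lemma linear_su3_projection: "linear su3_projection"
  unfolding su3_projection_def
  by (rule linearI) (simp_all add: vec_eq_iff forall_3 mat_def conj_transpose_def trace_def sum_3 complex_eq_iff field_simps)

locale bi_invariant_SU3 =
  fixes g :: "complex^3^3 \<Rightarrow> complex^3^3 \<Rightarrow> complex^3^3 \<Rightarrow> real"
  assumes bi_invariant: "bi_invariant_metric g"
begin

lemma metric: "riemannian_metric SU3 g"
  using bi_invariant by (simp add: bi_invariant_metric_def)

lemma g_sym: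
  "p \<in> SU3 \<Longrightarrow> u \<in> tangent_space SU3 p \<Longrightarrow> v \<in> tangent_space SU3 p \<Longrightarrow> g p u v = g p v u"
  using metric by (simp add: riemannian_metric_def)

lemma g_left:
  "h \<in> SU3 \<Longrightarrow> p \<in> SU3 \<Longrightarrow> u \<in> tangent_space SU3 p \<Longrightarrow> v \<in> tangent_space SU3 p
    \<Longrightarrow> g (h ** p) (h ** u) (h ** v) = g p u v"
  using bi_invariant by (simp add: bi_invariant_metric_def)

lemma g_right:
  "h \<in> SU3 \<Longrightarrow> p \<in> SU3 \<Longrightarrow> u \<in> tangent_space SU3 p \<Longrightarrow> v \<in> tangent_space SU3 p
    \<Longrightarrow> g (p ** h) (u ** h) (v ** h) = g p u v"
  using bi_invariant by (simp add: bi_invariant_metric_def)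

text \<open>
  The inner product at the identity, extended to all matrices so that it is a continuous bilinear
  map on a Euclidean space and the product rule applies.
\<close>

definition inner_one :: "complex^3^3 \<Rightarrow> complex^3^3 \<Rightarrow> real" where
  "inner_one X Y = g (mat 1) (su3_projection X) (su3_projection Y)"

lemma inner_one_sym: "inner_one X Y = inner_one Y X"
  unfolding inner_one_def by (rule g_sym) (auto simp: SU3_one tangent_space_SU3_one su3_projection_in)

lemma bounded_bilinear_inner_one: "bounded_bilinear inner_one"
proof -
  have lin: "g (mat 1) (a *\<^sub>R u + v) w = a * g (mat 1) u w + g (mat 1) v w"
    if "u \<in> su3" "v \<in> su3" "w \<in> su3" for a u v w
    using metric SU3_one that tangent_space_SU3_one unfolding riemannian_metric_def by blast
  have "linear (\<lambda>X. inner_one X Y)" for Y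
  proof (rule linearI)
    show "inner_one (X + X') Y = inner_one X Y + inner_one X' Y" for X X'
      using lin[of "su3_projection X" "su3_projection X'" "su3_projection Y" 1]
      by (simp add: inner_one_def su3_projection_in linear_add[OF linear_su3_projection])
    show "inner_one (a *\<^sub>R X) Y = a *\<^sub>R inner_one X Y" for a X
      using lin[of "su3_projection X" 0 "su3_projection Y" a]
        lin[of 0 0 "su3_projection Y" 1] subspace_0[OF subspace_su3]
      by (simp add: inner_one_def su3_projection_in linear_scale[OF linear_su3_projection])
  qed
  moreover from this have "linear (\<lambda>Y. inner_one X Y)" for X
    by (subst inner_one_sym)
  ultimately show ?thesis
    by (simp add: bilinear_def flip: bilinear_conv_bounded_bilinear)
qed

lemma g_eq_inner_one:
  assumes p: "p \<in> SU3" and u: "u \<in> tangent_space SU3 p" and v: "v \<in> tangent_space SU3 p"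
  shows "g p u v = inner_one (conj_transpose p ** u) (conj_transpose p ** v)"
  using g_left[OF SU3_conj_transpose[OF p] p u v]
  by (simp add: inner_one_def su3_projection_id tangent_space_SU3_imp_su3(2)[OF u]
      tangent_space_SU3_imp_su3(2)[OF v] SU3_left_inverse p)

lemma inner_one_Ad:
  assumes h: "h \<in> SU3" and X: "X \<in> su3" and Y: "Y \<in> su3"
  shows "inner_one (h ** X ** conj_transpose h) (h ** Y ** conj_transpose h) = inner_one X Y"
proof -
  have T: "X \<in> tangent_space SU3 (mat 1)" "Y \<in> tangent_space SU3 (mat 1)"
    using X Y by (simp_all add: tangent_space_SU3_one)
  have "g (h ** conj_transpose h) (h ** X ** conj_transpose h) (h ** Y ** conj_transpose h) = g (mat 1) X Y"
    using g_left[OF h SU3_one T] g_right[OF SU3_conj_transpose[OF h] SU3_mult[OF h SU3_one]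
        tangent_space_SU3_translate(1)[OF h T(1)] tangent_space_SU3_translate(1)[OF h T(2)]] by simp
  then show ?thesis
    using X Y h by (simp add: inner_one_def su3_projection_id su3_Ad SU3_right_inverse)
qed

text \<open>Differentiating \<open>Ad\<close>-invariance along a curve through the identity.\<close>

lemma inner_one_ad:
  assumes X: "X \<in> su3" and Y: "Y \<in> su3" and Z: "Z \<in> su3"
  shows "inner_one (X ** Y - Y ** X) Z + inner_one Y (X ** Z - Z ** X) = 0"
proof -
  obtain c e where c: "smooth_curve_in SU3 c e (mat 1) X"
    using X by (auto simp: tangent_space_iff simp flip: tangent_space_SU3_one)
  have c0: "c 0 = mat 1" and cX: "(c has_vector_derivative X) (at 0)"
    using c by (auto simp: smooth_curve_in_def)
  have ad: "((\<lambda>t. c t ** W ** conj_transpose (c t)) has_vector_derivative X ** W - W ** X) (at 0)" for W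
    using bounded_bilinear.has_vector_derivative[OF bounded_bilinear_matrix_mult
        bounded_linear.has_vector_derivative[OF
          bounded_bilinear.bounded_linear_left[OF bounded_bilinear_matrix_mult] cX]
        bounded_linear.has_vector_derivative[OF bounded_linear_conj_transpose cX], of W]
      X by (simp add: c0 su3_def matrix_mult_simps)
  show ?thesis
  proof (rule vector_derivative_eqI)
    show "((\<lambda>t. inner_one (c t ** Y ** conj_transpose (c t)) (c t ** Z ** conj_transpose (c t)))
      has_vector_derivative inner_one (X ** Y - Y ** X) Z + inner_one Y (X ** Z - Z ** X)) (at 0)"
      using bounded_bilinear.has_vector_derivative[OF bounded_bilinear_inner_one ad ad, of Y Z]
      by (simp add: c0 add.commute)
    show "((\<lambda>t. inner_one Y Z) has_vector_derivative 0) (at 0)" by (rule has_vector_derivative_const)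
    show "\<forall>\<^sub>F t in nhds 0. inner_one (c t ** Y ** conj_transpose (c t)) (c t ** Z ** conj_transpose (c t)) = inner_one Y Z"
      using smooth_curve_in_eventually[OF c] by eventually_elim (rule inner_one_Ad[OF _ Y Z])
  qed
qed

end

text \<open>
  In the left trivialization \<open>Y = p y\<close> the Levi-Civita connection of a bi-invariant metric is
  \<open>\<nabla>\<^sub>X Y = p (dy(X) + [x, y]/2)\<close>; expressed by the ambient derivative of \<open>Y\<close> it takes
  the following form.
\<close>

definition SU3_connection ::
  "(complex^3^3 \<Rightarrow> complex^3^3) \<Rightarrow> (complex^3^3 \<Rightarrow> complex^3^3) \<Rightarrow> complex^3^3 \<Rightarrow> complex^3^3" where
  "SU3_connection X Y p = differential SU3 Y p (X p)
     - (1/2) *\<^sub>R (X p ** conj_transpose p ** Y p + Y p ** conj_transpose p ** X p)"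

lemma vector_fieldsD:
  assumes "X \<in> vector_fields M"
  shows "smooth_map M X" "p \<in> M \<Longrightarrow> X p \<in> tangent_space M p"
    "p \<in> M \<Longrightarrow> X differentiable (at p within M)"
  using assms smooth_map_differentiable[of M X p] by (auto simp: vector_fields_def)

text \<open>
  The derivative of \<open>c\<^sup>* Y\<close> produces \<open>X\<^sup>* Y\<close>; since \<open>p\<^sup>* X\<close> is skew-Hermitian, \<open>X\<^sup>* = - p\<^sup>* X p\<^sup>*\<close>.
\<close>

lemma left_trivialization_derivative:
  assumes Y: "Y \<in> vector_fields SU3" and c: "smooth_curve_in SU3 c e p (X p)"
  shows "((\<lambda>t. conj_transpose (c t) ** Y (c t)) has_vector_derivative
    conj_transpose p ** SU3_connection X Y p - (1/2) *\<^sub>R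
      ((conj_transpose p ** X p) ** (conj_transpose p ** Y p)
       - (conj_transpose p ** Y p) ** (conj_transpose p ** X p))) (at 0)"
proof -
  have X: "X p \<in> tangent_space SU3 p" using c by (auto simp: tangent_space_iff)
  note p = tangent_space_SU3_imp_su3(1)[OF X]
  have c0: "c 0 = p" and cX: "(c has_vector_derivative X p) (at 0)"
    using c by (auto simp: smooth_curve_in_def)
  have "conj_transpose (conj_transpose p ** X p) = - (conj_transpose p ** X p)"
    using tangent_space_SU3_imp_su3(2)[OF X] by (simp add: su3_def)
  then have "conj_transpose (X p) ** p ** conj_transpose p = - (conj_transpose p ** X p ** conj_transpose p)"
    by (simp add: conj_transpose_mult matrix_mult_simps)
  then have ctX: "conj_transpose (X p) = - (conj_transpose p ** X p ** conj_transpose p)"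
    by (simp add: SU3_cancel_right p)
  have "((\<lambda>t. conj_transpose (c t) ** Y (c t)) has_vector_derivative
      conj_transpose p ** differential SU3 Y p (X p) + conj_transpose (X p) ** Y p) (at 0)"
    using bounded_bilinear.has_vector_derivative[OF bounded_bilinear_matrix_mult
        bounded_linear.has_vector_derivative[OF bounded_linear_conj_transpose cX]
        has_vector_derivative_along_curve[OF c vector_fieldsD(3)[OF Y p]]]
    by (simp add: c0)
  moreover have "conj_transpose p ** SU3_connection X Y p - (1/2) *\<^sub>R
      ((conj_transpose p ** X p) ** (conj_transpose p ** Y p)
       - (conj_transpose p ** Y p) ** (conj_transpose p ** X p))
     = conj_transpose p ** differential SU3 Y p (X p) - conj_transpose p ** X p ** conj_transpose p ** Y p"
  proof -
    have half: "D - (1/2) *\<^sub>R (A + B) - (1/2) *\<^sub>R (A - B) = D - A" for A B D :: "complex^3^3"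
      by (simp add: scaleR_add_right scaleR_diff_right flip: scaleR_add_left)
    show ?thesis
      unfolding SU3_connection_def by (simp only: matrix_mult_simps matrix_mul_assoc half)
  qed
  ultimately show ?thesis by (simp add: ctX matrix_mult_simps)
qed

text \<open>
  The left trivialization of \<open>Y\<close> moves inside the linear space \<open>su(3)\<close>, so its derivative stays there, and
  so does the bracket.
\<close>

lemma SU3_connection_tangent:
  assumes X: "X \<in> vector_fields SU3" and Y: "Y \<in> vector_fields SU3" and p: "p \<in> SU3"
  shows "SU3_connection X Y p \<in> tangent_space SU3 p"
proof -
  obtain c e where c: "smooth_curve_in SU3 c e p (X p)"
    using vector_fieldsD(2)[OF X p] by (auto simp: tangent_space_iff)
  let ?x = "conj_transpose p ** X p" and ?y = "conj_transpose p ** Y p"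
  have xy: "?x \<in> su3" "?y \<in> su3"
    using vector_fieldsD(2)[OF X p] vector_fieldsD(2)[OF Y p] by (auto dest: tangent_space_SU3_imp_su3)
  have "conj_transpose p ** SU3_connection X Y p - (1/2) *\<^sub>R (?x ** ?y - ?y ** ?x) \<in> su3"
    by (rule su3_derivative[OF left_trivialization_derivative[of _ _ _ _ X, OF Y c]])
      (use smooth_curve_in_eventually[OF c] in eventually_elim,
        auto dest: tangent_space_SU3_imp_su3 vector_fieldsD(2)[OF Y])
  from subspace_add[OF subspace_su3 this
      subspace_scale[OF subspace_su3 su3_bracket[OF xy], of "1/2"]]
  show ?thesis by (simp add: tangent_space_SU3_iff p)
qed

lemma SU3_connection_vector_field:
  assumes X: "X \<in> vector_fields SU3" and Y: "Y \<in> vector_fields SU3"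
  shows "SU3_connection X Y \<in> vector_fields SU3"
proof -
  note sX = vector_fieldsD(1)[OF X] and sY = vector_fieldsD(1)[OF Y]
  note m = smooth_map_bilinear[OF bounded_bilinear_matrix_mult]
  have triple: "smooth_map SU3 (\<lambda>p. U p ** conj_transpose p ** V p)"
    if "smooth_map SU3 U" "smooth_map SU3 V" for U V :: "complex^3^3 \<Rightarrow> complex^3^3"
    using m[OF m[OF that(1) smooth_map_linear[OF bounded_linear_conj_transpose smooth_map_ident]] that(2)] .
  have "smooth_map SU3 (\<lambda>p. differential SU3 Y p (X p)
     + (- (1/2)) *\<^sub>R (X p ** conj_transpose p ** Y p + Y p ** conj_transpose p ** X p))"
    by (intro smooth_map_add smooth_map_linear[OF bounded_linear_scaleR_right] triple sX sY
        smooth_map_differential vector_fieldsD(2)[OF X])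
  then have "smooth_map SU3 (SU3_connection X Y)"
    by (simp add: SU3_connection_def[abs_def])
  then show ?thesis
    using SU3_connection_tangent[OF X Y] by (simp add: vector_fields_def)
qed

text \<open>
  In the left trivialization the metric is the fixed inner product at the identity, so the product
  rule gives \<open>\<langle>y', z\<rangle> + \<langle>y, z'\<rangle>\<close>. Replacing \<open>y'\<close> by the covariant derivative adds \<open>[x, y]/2\<close>, and by
  \<open>ad\<close>-invariance the two additional terms cancel.
\<close>

lemma (in bi_invariant_SU3) SU3_connection_metric:
  assumes X: "X \<in> vector_fields SU3" and Y: "Y \<in> vector_fields SU3" and Z: "Z \<in> vector_fields SU3"
    and p: "p \<in> SU3"
  shows "differential SU3 (\<lambda>q. g q (Y q) (Z q)) p (X p)
    = g p (SU3_connection X Y p) (Z p) + g p (Y p) (SU3_connection X Z p)"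
proof -
  obtain c e where c: "smooth_curve_in SU3 c e p (X p)"
    using vector_fieldsD(2)[OF X p] by (auto simp: tangent_space_iff)
  let ?x = "conj_transpose p ** X p" and ?y = "conj_transpose p ** Y p" and ?z = "conj_transpose p ** Z p"
  let ?ny = "conj_transpose p ** SU3_connection X Y p" and ?nz = "conj_transpose p ** SU3_connection X Z p"
  have xyz: "?x \<in> su3" "?y \<in> su3" "?z \<in> su3"
    using X Y Z p by (auto dest: tangent_space_SU3_imp_su3 vector_fieldsD(2))
  interpret inner_one: bounded_bilinear inner_one by (rule bounded_bilinear_inner_one)
  have "smooth_map SU3 (\<lambda>q. g q (Y q) (Z q))"
    using metric Y Z unfolding riemannian_metric_def by blast
  then have d: "((\<lambda>t. g (c t) (Y (c t)) (Z (c t))) has_vector_derivative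
      differential SU3 (\<lambda>q. g q (Y q) (Z q)) p (X p)) (at 0)"
    using has_vector_derivative_along_curve[OF c] smooth_map_differentiable p by blast
  have d': "((\<lambda>t. inner_one (conj_transpose (c t) ** Y (c t)) (conj_transpose (c t) ** Z (c t)))
      has_vector_derivative inner_one ?y (?nz - (1/2) *\<^sub>R (?x ** ?z - ?z ** ?x))
        + inner_one (?ny - (1/2) *\<^sub>R (?x ** ?y - ?y ** ?x)) ?z) (at 0)"
    using bounded_bilinear.has_vector_derivative[OF bounded_bilinear_inner_one
        left_trivialization_derivative[of _ _ _ _ X, OF Y c] left_trivialization_derivative[of _ _ _ _ X, OF Z c]] c
    by (simp add: smooth_curve_in_def)
  have "differential SU3 (\<lambda>q. g q (Y q) (Z q)) p (X p)
    = inner_one ?y (?nz - (1/2) *\<^sub>R (?x ** ?z - ?z ** ?x)) + inner_one (?ny - (1/2) *\<^sub>R (?x ** ?y - ?y ** ?x)) ?z"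
    by (rule vector_derivative_eqI[OF d d'])
      (use smooth_curve_in_eventually[OF c] in eventually_elim,
        auto intro: g_eq_inner_one vector_fieldsD(2) Y Z)
  also have "\<dots> = inner_one ?y ?nz + inner_one ?ny ?z
      - (1/2) * (inner_one (?x ** ?y - ?y ** ?x) ?z + inner_one ?y (?x ** ?z - ?z ** ?x))"
    by (simp only: inner_one.diff_left[of ?ny] inner_one.diff_right[of ?y ?nz] inner_one.scaleR_left inner_one.scaleR_right)
      (simp add: algebra_simps)
  also have "\<dots> = inner_one ?ny ?z + inner_one ?y ?nz"
    unfolding inner_one_ad[OF xyz] by simp
  also have "\<dots> = g p (SU3_connection X Y p) (Z p) + g p (Y p) (SU3_connection X Z p)"
    using X Y Z p by (simp add: g_eq_inner_one SU3_connection_tangent vector_fieldsD(2))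
  finally show ?thesis .
qed

lemma (in bi_invariant_SU3) is_levi_civita_SU3_connection:
  "is_levi_civita SU3 g SU3_connection"
  unfolding is_levi_civita_def
proof (intro conjI ballI allI impI)
  fix X X' Y Y' and f :: "complex^3^3 \<Rightarrow> real" and p
  assume X: "X \<in> vector_fields SU3" and Y: "Y \<in> vector_fields SU3" and p: "p \<in> SU3"
    and f: "smooth_map SU3 f"
  interpret mm: bounded_bilinear "(**) :: complex^3^3 \<Rightarrow> complex^3^3 \<Rightarrow> complex^3^3"
    by (rule bounded_bilinear_matrix_mult)
  {
    assume X': "X' \<in> vector_fields SU3"
    show "SU3_connection (\<lambda>q. f q *\<^sub>R X q + X' q) Y p = f p *\<^sub>R SU3_connection X Y p + SU3_connection X' Y p"
      by (simp add: SU3_connection_def linear_add[OF linear_differential[OF vector_fieldsD(3)[OF Y p]]]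
          linear_scale[OF linear_differential[OF vector_fieldsD(3)[OF Y p]]]
          mm.add_left mm.add_right mm.scaleR_left mm.scaleR_right algebra_simps)
  }
  assume Y': "Y' \<in> vector_fields SU3"
  obtain c e where c: "smooth_curve_in SU3 c e p (X p)"
    using vector_fieldsD(2)[OF X p] by (auto simp: tangent_space_iff)
  have "smooth_map SU3 (\<lambda>q. f q *\<^sub>R Y q + Y' q)"
    by (intro smooth_map_add smooth_map_bilinear[OF bounded_bilinear_scaleR] f vector_fieldsD(1) Y Y')
  note dif = smooth_map_differentiable[OF this p]
  have "differential SU3 (\<lambda>q. f q *\<^sub>R Y q + Y' q) p (X p)
    = f p *\<^sub>R differential SU3 Y p (X p) + differential SU3 f p (X p) *\<^sub>R Y p + differential SU3 Y' p (X p)"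
    using has_vector_derivative_add[OF bounded_bilinear.has_vector_derivative[OF bounded_bilinear_scaleR
        has_vector_derivative_along_curve[OF c smooth_map_differentiable[OF f p]]
        has_vector_derivative_along_curve[OF c vector_fieldsD(3)[OF Y p]]]
        has_vector_derivative_along_curve[OF c vector_fieldsD(3)[OF Y' p]]] c
    by (intro differential_eqI[OF c dif]) (simp add: smooth_curve_in_def)
  then show "SU3_connection X (\<lambda>q. f q *\<^sub>R Y q + Y' q) p =
      differential SU3 f p (X p) *\<^sub>R Y p + f p *\<^sub>R SU3_connection X Y p + SU3_connection X Y' p"
    by (simp add: SU3_connection_def mm.add_left mm.add_right mm.scaleR_left mm.scaleR_right algebra_simps)
qed (auto simp: SU3_connection_vector_field SU3_connection_metric SU3_connection_def lie_bracket_def add.commute)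

lemma (in bi_invariant_SU3) levi_civita_SU3:
  assumes "X \<in> vector_fields SU3" "Y \<in> vector_fields SU3" "p \<in> SU3"
  shows "levi_civita SU3 g X Y p = SU3_connection X Y p"
  unfolding levi_civita_def
  by (rule levi_civita_unique[OF metric subspace_tangent_space_SU3 _
        someI[of "is_levi_civita SU3 g"] is_levi_civita_SU3_connection])
    (use assms is_levi_civita_SU3_connection in auto)


section \<open>Equivariance of the embedding\<close>

definition outer :: "complex^3 \<Rightarrow> complex^3 \<Rightarrow> complex^3^3" where
  "outer z w = (\<chi> i j. z $ i * w $ j)"

definition skew :: "complex^3 \<Rightarrow> complex^3^3" where
  "skew z = vector [vector [0, - cnj (z $ 3), cnj (z $ 2)],
                    vector [cnj (z $ 3), 0, - cnj (z $ 1)],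
                    vector [- cnj (z $ 2), cnj (z $ 1), 0]]"

definition eta_deriv :: "complex^3 \<Rightarrow> complex^3 \<Rightarrow> complex^3^3" where
  "eta_deriv z w = outer z w + outer w z + skew w"

text \<open>
  The antisymmetric part of \<open>\<eta>(z)\<close> determines \<open>z\<close>. This real linear left inverse serves
  \<open>\<eta>\<close> and its differentials alike and turns curves and fields in the image into curves and
  fields in \<open>\<complex>\<^sup>3\<close>.
\<close>

definition eta_coord :: "complex^3^3 \<Rightarrow> complex^3" where
  "eta_coord q = vector [cnj (q $ 3 $ 2 - q $ 2 $ 3) / 2, cnj (q $ 1 $ 3 - q $ 3 $ 1) / 2,
                         cnj (q $ 2 $ 1 - q $ 1 $ 2) / 2]"

definition herm :: "complex^3 \<Rightarrow> complex^3 \<Rightarrow> complex" where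
  "herm z w = (\<Sum>i\<in>UNIV. cnj (z $ i) * w $ i)"

lemma eta_eq: "eta z = outer z z + skew z"
  by (simp add: eta_def outer_def skew_def)

lemma bounded_bilinear_outer: "bounded_bilinear outer"
proof -
  have "bilinear outer"
    unfolding bilinear_def by (auto intro!: linearI simp: outer_def vec_eq_iff algebra_simps)
  then show ?thesis by (simp add: bilinear_conv_bounded_bilinear)
qed

lemma bounded_linear_skew: "bounded_linear skew"
  unfolding linear_conv_bounded_linear[symmetric]
  by (rule linearI) (simp_all add: skew_def vec_eq_iff forall_3)

lemma bounded_linear_eta_coord: "bounded_linear eta_coord"
  unfolding linear_conv_bounded_linear[symmetric]
  by (rule linearI) (simp_all add: eta_coord_def vec_eq_iff forall_3 complex_eq_iff field_simps)

lemma eta_coord_eta [simp]: "eta_coord (eta z) = z"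
  by (simp add: eta_coord_def eta_eq outer_def skew_def vec_eq_iff forall_3)

lemma eta_coord_eta_deriv [simp]: "eta_coord (eta_deriv z w) = w"
  by (simp add: eta_coord_def eta_deriv_def outer_def skew_def vec_eq_iff forall_3)

lemma linear_eta_deriv: "linear (eta_deriv z)"
  unfolding eta_deriv_def
  by (intro linear_compose_add bounded_linear.linear[OF bounded_linear_skew]
      bounded_linear.linear[OF bounded_bilinear.bounded_linear_left[OF bounded_bilinear_outer]]
      bounded_linear.linear[OF bounded_bilinear.bounded_linear_right[OF bounded_bilinear_outer]])

lemma inner_eq_Re_herm: "z \<bullet> w = Re (herm z w)"
  by (simp add: inner_vec_def herm_def inner_complex_def)

lemma herm_cnj: "cnj (herm z w) = herm w z"
  by (simp add: herm_def mult.commute)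

lemma herm_self: "herm z z = complex_of_real (z \<bullet> z)"
  unfolding inner_eq_Re_herm using herm_cnj[of z z] by (simp add: complex_eq_iff)

lemma herm_matrix: "herm (B *v z) w = herm z (conj_transpose B *v w)"
  by (simp add: herm_def matrix_vector_mult_def conj_transpose_def sum_3 algebra_simps)

lemma SU3_inner: "A \<in> SU3 \<Longrightarrow> (A *v z) \<bullet> (A *v w) = z \<bullet> w"
  by (simp add: inner_eq_Re_herm herm_matrix matrix_vector_mul_assoc SU3_left_inverse)

text \<open>For \<open>A\<close> in SU(3) the inverse \<open>A\<^sup>*\<close> is the adjugate, so \<open>cnj A\<close> consists of the cofactors of \<open>A\<close>.\<close>

lemma SU3_cofactors:
  assumes A: "A \<in> SU3"
  shows "cnj (A$1$1) = A$2$2 * A$3$3 - A$2$3 * A$3$2" "cnj (A$1$2) = A$2$3 * A$3$1 - A$2$1 * A$3$3"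
    "cnj (A$1$3) = A$2$1 * A$3$2 - A$2$2 * A$3$1" "cnj (A$2$1) = A$1$3 * A$3$2 - A$1$2 * A$3$3"
    "cnj (A$2$2) = A$1$1 * A$3$3 - A$1$3 * A$3$1" "cnj (A$2$3) = A$1$2 * A$3$1 - A$1$1 * A$3$2"
    "cnj (A$3$1) = A$1$2 * A$2$3 - A$1$3 * A$2$2" "cnj (A$3$2) = A$1$3 * A$2$1 - A$1$1 * A$2$3"
    "cnj (A$3$3) = A$1$1 * A$2$2 - A$1$2 * A$2$1"
proof -
  define adj :: "complex^3^3" where "adj = vector
   [vector [A$2$2 * A$3$3 - A$2$3 * A$3$2, A$1$3 * A$3$2 - A$1$2 * A$3$3, A$1$2 * A$2$3 - A$1$3 * A$2$2],
    vector [A$2$3 * A$3$1 - A$2$1 * A$3$3, A$1$1 * A$3$3 - A$1$3 * A$3$1, A$1$3 * A$2$1 - A$1$1 * A$2$3],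
    vector [A$2$1 * A$3$2 - A$2$2 * A$3$1, A$1$2 * A$3$1 - A$1$1 * A$3$2, A$1$1 * A$2$2 - A$1$2 * A$2$1]]"
  have "A ** adj = mat (det A)"
    by (simp add: adj_def matrix_matrix_mult_def vec_eq_iff forall_3 sum_3 det_3 mat_def algebra_simps)
  then have "A ** adj = mat 1" using A by (simp add: SU3_def)
  then have "conj_transpose A = adj"
    by (metis A SU3_left_inverse matrix_mul_assoc matrix_mul_lid matrix_mul_rid)
  then have "\<forall>i j. cnj (A $ j $ i) = adj $ i $ j"
    by (simp add: conj_transpose_def vec_eq_iff)
  then show "cnj (A$1$1) = A$2$2 * A$3$3 - A$2$3 * A$3$2" "cnj (A$1$2) = A$2$3 * A$3$1 - A$2$1 * A$3$3"
    "cnj (A$1$3) = A$2$1 * A$3$2 - A$2$2 * A$3$1" "cnj (A$2$1) = A$1$3 * A$3$2 - A$1$2 * A$3$3"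
    "cnj (A$2$2) = A$1$1 * A$3$3 - A$1$3 * A$3$1" "cnj (A$2$3) = A$1$2 * A$3$1 - A$1$1 * A$3$2"
    "cnj (A$3$1) = A$1$2 * A$2$3 - A$1$3 * A$2$2" "cnj (A$3$2) = A$1$3 * A$2$1 - A$1$1 * A$2$3"
    "cnj (A$3$3) = A$1$1 * A$2$2 - A$1$2 * A$2$1"
    by (simp_all add: adj_def)
qed

lemma outer_equivariant: "outer (A *v z) (B *v w) = A ** outer z w ** transpose B"
  by (simp add: outer_def matrix_matrix_mult_def matrix_vector_mult_def transpose_def vec_eq_iff
      sum_3 algebra_simps)

text \<open>
  This is \<open>A x \<times> A y = cnj A (x \<times> y)\<close> in matrix form, \<open>skew z\<close> being the cross product with \<open>cnj z\<close>.
\<close>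

lemma skew_equivariant:
  assumes "A \<in> SU3"
  shows "skew (A *v z) = A ** skew z ** transpose A"
  by (simp add: skew_def matrix_matrix_mult_def matrix_vector_mult_def transpose_def vec_eq_iff
      forall_3 sum_3 SU3_cofactors[OF assms] algebra_simps)

lemma eta_equivariant: "A \<in> SU3 \<Longrightarrow> eta (A *v z) = A ** eta z ** transpose A"
  by (simp add: eta_eq outer_equivariant skew_equivariant matrix_mult_simps)

lemma eta_deriv_equivariant:
  "A \<in> SU3 \<Longrightarrow> eta_deriv (A *v z) (A *v w) = A ** eta_deriv z w ** transpose A"
  by (simp add: eta_deriv_def outer_equivariant skew_equivariant matrix_mult_simps)

text \<open>The derivative of equivariance at the identity.\<close>

lemma eta_infinitesimally_equivariant:
  assumes a: "a \<in> su3"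
  shows "a ** eta z + eta z ** transpose a = eta_deriv z (a *v z)"
proof -
  have sk: "cnj (a $ j $ i) = - a $ i $ j" for i j
    using a by (auto simp: su3_def conj_transpose_def vec_eq_iff)
  have tr: "a $ 1 $ 1 = - a $ 2 $ 2 - a $ 3 $ 3"
    using a by (simp add: su3_def trace_def sum_3 algebra_simps eq_neg_iff_add_eq_0)
  have "a ** skew z + skew z ** transpose a = skew (a *v z)"
    by (simp add: skew_def matrix_matrix_mult_def matrix_vector_mult_def transpose_def vec_eq_iff
        forall_3 sum_3 sk tr algebra_simps)
  moreover have "a ** outer z z = outer (a *v z) z" "outer z z ** transpose a = outer z (a *v z)"
    using outer_equivariant[of a z "mat 1" z] outer_equivariant[of "mat 1" z a z] by simp_all
  ultimately show ?thesis
    by (simp add: eta_eq eta_deriv_def matrix_mult_simps algebra_simps)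
qed

definition e1 :: "complex^3" where "e1 = vector [1, 0, 0]"

lemma unit_perpendicular_exists:
  fixes z :: "complex^3"
  obtains w where "herm z w = 0" "herm w w = 1"
proof (cases "z $ 1 = 0 \<and> z $ 2 = 0")
  case True
  show ?thesis
    by (rule that[of "vector [1, 0, 0]"]) (use True in \<open>simp_all add: herm_def sum_3\<close>)
next
  case False
  define v :: "complex^3" where "v = vector [- cnj (z $ 2), cnj (z $ 1), 0]"
  have "v \<noteq> 0" using False by (auto simp: v_def vec_eq_iff forall_3)
  then have n: "norm v \<noteq> 0" by simp
  have vv: "herm v v = complex_of_real (norm v * norm v)"
    by (simp add: herm_self dot_square_norm power2_eq_square)
  have zv: "herm z v = 0" by (simp add: herm_def sum_3 v_def)
  have sc: "herm x (r *\<^sub>R y) = r * herm x y" "herm (r *\<^sub>R x) y = r * herm x y" for r x y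
    by (simp_all add: herm_def sum_3) (simp_all add: scaleR_conv_of_real algebra_simps)
  show ?thesis
    by (rule that[of "v /\<^sub>R norm v"]) (use n in \<open>simp_all add: sc zv vv field_simps\<close>)
qed

text \<open>
  Complete \<open>z\<close> to a unitary frame \<open>z, w\<close> and \<open>cnj (z \<times> w)\<close>; the last column makes the determinant
  \<open>|z \<times> w|\<^sup>2\<close>, which is 1 by the Lagrange identity.
\<close>

lemma SU3_transitive:
  assumes z: "norm z = 1"
  obtains A where "A \<in> SU3" "A *v e1 = z"
proof -
  obtain w where zw: "herm z w = 0" and ww: "herm w w = 1" using unit_perpendicular_exists .
  have zz: "herm z z = 1" using z by (simp add: herm_self dot_square_norm)
  define c1 c2 c3 where "c1 = z$2 * w$3 - z$3 * w$2" and "c2 = z$3 * w$1 - z$1 * w$3"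
    and "c3 = z$1 * w$2 - z$2 * w$1"
  define A :: "complex^3^3" where "A = vector [vector [z$1, w$1, cnj c1], vector [z$2, w$2, cnj c2],
     vector [z$3, w$3, cnj c3]]"
  have "c1 * cnj c1 + c2 * cnj c2 + c3 * cnj c3 = herm z z * herm w w - herm z w * herm w z"
    by (simp add: c1_def c2_def c3_def herm_def sum_3 algebra_simps)
  then have cc: "c1 * cnj c1 + c2 * cnj c2 + c3 * cnj c3 = 1" by (simp add: zz ww zw)
  have zc: "z$1 * c1 + z$2 * c2 + z$3 * c3 = 0" and wc: "w$1 * c1 + w$2 * c2 + w$3 * c3 = 0"
    by (simp_all add: c1_def c2_def c3_def algebra_simps)
  have "det A = c1 * cnj c1 + c2 * cnj c2 + c3 * cnj c3"
    unfolding det_3 by (simp add: A_def c1_def c2_def c3_def algebra_simps)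
  then have "det A = 1" using cc by simp
  moreover have "cnj (z$1) * cnj c1 + cnj (z$2) * cnj c2 + cnj (z$3) * cnj c3 = 0"
    "cnj (w$1) * cnj c1 + cnj (w$2) * cnj c2 + cnj (w$3) * cnj c3 = 0"
    using arg_cong[OF zc, of cnj] arg_cong[OF wc, of cnj] by simp_all
  moreover have "herm w z = 0" using herm_cnj[of z w] zw by simp
  ultimately have "conj_transpose A ** A = mat 1"
    using zz ww zw cc zc wc
    by (simp add: vec_eq_iff forall_3 matrix_matrix_mult_def conj_transpose_def sum_3 mat_def A_def
        herm_def mult.commute)
  moreover note \<open>det A = 1\<close>
  moreover have "A *v e1 = z"
    by (simp add: A_def e1_def matrix_vector_mult_def vec_eq_iff forall_3 sum_3)
  ultimately show ?thesis using that[of A] by (simp add: SU3_def)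
qed

text \<open>
  The infinitesimal version. The matrix \<open>w z\<^sup>* - z w\<^sup>*\<close> maps \<open>z\<close> to \<open>w + h z\<close> with the imaginary
  number \<open>h = z\<^sup>* w\<close>, and its trace is \<open>2 h\<close>; subtracting \<open>h (z z\<^sup>* + 1)/2\<close> corrects both.
\<close>

lemma su3_transitive:
  assumes z: "norm z = 1" and w: "z \<bullet> w = 0"
  obtains a where "a \<in> su3" "a *v z = w"
proof -
  define h where "h = herm z w"
  have zz: "herm z z = 1" using z by (simp add: herm_self dot_square_norm)
  have cnjh: "cnj h = - h" using w by (simp add: h_def inner_eq_Re_herm complex_eq_iff)
  then have wz: "herm w z = - h" using herm_cnj[of z w] by (simp add: h_def)
  define a :: "complex^3^3" where
    "a = (\<chi> i j. w$i * cnj (z$j) - z$i * cnj (w$j) - h/2 * z$i * cnj (z$j) - (if i = j then h/2 else 0))"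
  have "trace a = herm z w - herm w z - h/2 * herm z z - 3 * h/2"
    by (simp add: trace_def a_def herm_def sum_3 algebra_simps)
  then have "trace a = 0" by (simp add: zz wz flip: h_def)
  moreover have "conj_transpose a = - a"
    by (simp add: conj_transpose_def a_def vec_eq_iff cnjh algebra_simps)
  moreover have "a *v z = w"
  proof -
    have "(a *v z) $ i = w$i * herm z z - z$i * herm w z - h/2 * z$i * herm z z - h/2 * z$i" for i
      using exhaust_3[of i]
      by (auto simp: matrix_vector_mult_def a_def herm_def sum_3 algebra_simps)
    then show ?thesis by (simp add: vec_eq_iff zz wz)
  qed
  ultimately show ?thesis using that[of a] by (simp add: su3_def)
qed


section \<open>The submanifold\<close>

abbreviation (input) S5 :: "(complex^3) set" where "S5 \<equiv> sphere 0 1"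

text \<open>By equivariance it suffices to look at one point.\<close>

lemma eta_in_SU3:
  assumes "z \<in> S5" shows "eta z \<in> SU3"
proof -
  have "eta e1 \<in> SU3"
    by (simp add: SU3_def eta_def e1_def conj_transpose_def matrix_matrix_mult_def vec_eq_iff
        forall_3 sum_3 det_3 mat_def)
  moreover obtain A where "A \<in> SU3" "A *v e1 = z" using SU3_transitive[of z] assms by auto
  ultimately show ?thesis
    using eta_equivariant[of A e1] by (simp add: SU3_mult SU3_transpose)
qed

lemma smooth_on_open_eta_comp:
  "smooth_on_open U c \<Longrightarrow> smooth_on_open U (\<lambda>t. eta (c t))"
  unfolding eta_eq
  by (intro smooth_on_open_add smooth_on_open_bilinear[OF bounded_bilinear_outer]
      smooth_on_open_linear[OF bounded_linear_skew])

lemma has_vector_derivative_eta: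
  assumes "(c has_vector_derivative w) (at t)"
  shows "((\<lambda>t. eta (c t)) has_vector_derivative eta_deriv (c t) w) (at t)"
  unfolding eta_eq eta_deriv_def
  by (intro has_vector_derivative_add bounded_bilinear.has_vector_derivative[OF bounded_bilinear_outer]
      bounded_linear.has_vector_derivative[OF bounded_linear_skew] assms)

lemma great_circle:
  assumes z: "z \<in> S5" and w: "z \<bullet> w = 0"
  obtains c where "smooth_curve_in S5 c 1 z w"
proof -
  let ?r = "norm w" and ?c = "\<lambda>t. 0 + cos (norm w * t) *\<^sub>R z + sin (norm w * t) *\<^sub>R (w /\<^sub>R norm w)"
  have zz: "z \<bullet> z = 1" using z by (simp add: dot_square_norm)
  have "?c t \<bullet> ?c t = 1" for t
  proof (cases "w = 0")
    case False
    then have "(w /\<^sub>R ?r) \<bullet> (w /\<^sub>R ?r) = 1" "z \<bullet> (w /\<^sub>R ?r) = 0"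
      using w by (simp_all add: dot_square_norm power2_eq_square)
    moreover have "(0 + a *\<^sub>R z + b *\<^sub>R x) \<bullet> (0 + a *\<^sub>R z + b *\<^sub>R x)
        = a\<^sup>2 * (z \<bullet> z) + 2 * a * b * (z \<bullet> x) + b\<^sup>2 * (x \<bullet> x)" for a b x
      by (simp add: inner_add_left inner_add_right inner_commute[of x z] power2_eq_square algebra_simps)
    ultimately show ?thesis by (simp only: zz) simp
  qed (simp add: zz)
  then have "?c t \<in> S5" for t by (simp add: norm_eq_sqrt_inner)
  moreover have "(?c has_vector_derivative w) (at 0)"
    using has_vector_derivative_circle[of 0 ?r z "w /\<^sub>R ?r" 0] by (cases "w = 0") auto
  moreover have "smooth_on_open {-1<..<1} ?c" by (rule smooth_on_open_circle) simp
  moreover have "?c 0 = z" by simp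
  ultimately have "smooth_curve_in S5 ?c 1 z w"
    unfolding smooth_curve_in_def by (blast intro: zero_less_one)
  then show ?thesis by (rule that)
qed

text \<open>
  Curves in the image are images of curves in the sphere by \<open>eta_coord\<close>; conversely great circles realize
  all tangent directions of the sphere.
\<close>

lemma tangent_space_eta_image:
  assumes z: "z \<in> S5"
  shows "tangent_space (eta ` S5) (eta z) = {eta_deriv z w |w. z \<bullet> w = 0}"
proof (intro set_eqI iffI)
  fix v assume "v \<in> tangent_space (eta ` S5) (eta z)"
  then obtain c e where c: "smooth_curve_in (eta ` S5) c e (eta z) v"
    by (auto simp: tangent_space_iff)
  let ?z = "\<lambda>t. eta_coord (c t)"
  have ev: "\<forall>\<^sub>F t in nhds 0. c t = eta (?z t) \<and> ?z t \<bullet> ?z t = 1"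
    using smooth_curve_in_eventually[OF c] by eventually_elim (auto simp: dot_square_norm)
  have z0: "?z 0 = z" and v: "(c has_vector_derivative v) (at 0)"
    using c by (auto simp: smooth_curve_in_def)
  have z': "(?z has_vector_derivative eta_coord v) (at 0)"
    using bounded_linear.has_vector_derivative[OF bounded_linear_eta_coord v] .
  have "v = eta_deriv z (eta_coord v)"
    using vector_derivative_eqI[OF v has_vector_derivative_eta[OF z'] eventually_mono[OF ev]] z0
    by simp
  moreover have "z \<bullet> eta_coord v + eta_coord v \<bullet> z = 0"
    using vector_derivative_eqI[OF bounded_bilinear.has_vector_derivative[OF bounded_bilinear_inner z' z']
        has_vector_derivative_const[of 1] eventually_mono[OF ev]] z0
    by simp
  then have "z \<bullet> eta_coord v = 0" by (simp add: inner_commute)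
  ultimately show "v \<in> {eta_deriv z w |w. z \<bullet> w = 0}" by blast
next
  fix v assume "v \<in> {eta_deriv z w |w. z \<bullet> w = 0}"
  then obtain w where w: "z \<bullet> w = 0" and v: "v = eta_deriv z w" by blast
  obtain c where c: "smooth_curve_in S5 c 1 z w" using great_circle[OF z w] .
  then have "smooth_curve_in (eta ` S5) (\<lambda>t. eta (c t)) 1 (eta z) v"
    using has_vector_derivative_eta[OF smooth_curve_in_vector_derivative[OF c]]
    by (auto simp: smooth_curve_in_def v intro: smooth_on_open_eta_comp)
  then show "v \<in> tangent_space (eta ` S5) (eta z)"
    by (auto simp: tangent_space_iff)
qed

lemma tangent_space_mono: "N \<subseteq> M \<Longrightarrow> tangent_space N p \<subseteq> tangent_space M p"
  unfolding tangent_space_def by blast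

lemma subspace_tangent_space_eta:
  assumes "z \<in> S5" shows "subspace (tangent_space (eta ` S5) (eta z))"
proof -
  have "tangent_space (eta ` S5) (eta z) = eta_deriv z ` {w. z \<bullet> w = 0}"
    unfolding tangent_space_eta_image[OF assms] by auto
  then show ?thesis
    using linear_subspace_image[OF linear_eta_deriv subspace_hyperplane] by simp
qed

lemma smooth_embedding_eta: "smooth_embedding S5 SU3 eta"
  unfolding smooth_embedding_def
proof (intro conjI ballI)
  show sm: "smooth_map S5 eta"
    by (intro smooth_on_open_UNIV_imp_smooth_map smooth_on_open_eta_comp smooth_on_open_ident) simp
  fix z assume z: "z \<in> S5"
  show "inj_on (differential S5 eta z) (tangent_space S5 z)"
  proof (rule inj_on_inverseI)
    fix w assume "w \<in> tangent_space S5 z"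
    then obtain c e where c: "smooth_curve_in S5 c e z w" by (auto simp: tangent_space_iff)
    have "differential S5 eta z w = eta_deriv z w"
      using differential_eqI[OF c smooth_map_differentiable[OF sm z]
          has_vector_derivative_eta[OF smooth_curve_in_vector_derivative[OF c]]] c
      by (simp add: smooth_curve_in_def)
    then show "eta_coord (differential S5 eta z w) = w" by simp
  qed
next
  have "continuous_on S5 eta"
    unfolding eta_eq
    by (intro continuous_intros bounded_bilinear.continuous_on[OF bounded_bilinear_outer]
        bounded_linear.continuous_on[OF bounded_linear_skew])
  moreover have "continuous_on (eta ` S5) eta_coord"
    by (intro linear_continuous_on bounded_linear_eta_coord)
  ultimately show "\<exists>h. homeomorphism S5 (eta ` S5) eta h"
    by (intro exI[of _ eta_coord]) (auto simp: homeomorphism_def image_image)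
qed (use eta_in_SU3 in auto)

text \<open>
  The Killing fields \<open>q \<mapsto> a q + q a\<^sup>t\<close> of the action are tangent to all of \<open>SU(3)\<close> and, along
  the orbit, to the orbit; since the orbit map is a submersion onto it, they take every tangent value.
\<close>

lemma tangential_extension_exists:
  assumes z: "z \<in> S5" and u: "u \<in> tangent_space (eta ` S5) (eta z)"
  shows "\<exists>U. tangential_extension SU3 (eta ` S5) (eta z) u U"
proof -
  obtain w where w: "z \<bullet> w = 0" and uw: "u = eta_deriv z w"
    using u unfolding tangent_space_eta_image[OF z] by blast
  obtain a where a: "a \<in> su3" "a *v z = w" using su3_transitive[OF _ w] z by auto
  let ?U = "\<lambda>q. a ** q + q ** transpose a"
  have at: "transpose a \<in> su3"
    using a(1) by (auto simp: su3_def conj_transpose_def trace_def transpose_def vec_eq_iff)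
  have "?U q \<in> tangent_space SU3 q" if "q \<in> SU3" for q
    using tangent_space_SU3_mult[OF a(1)[folded tangent_space_SU3_one] tangent_space_zero[OF that]]
      tangent_space_SU3_mult[OF tangent_space_zero[OF that] at[folded tangent_space_SU3_one]]
    by (intro subspace_add[OF subspace_tangent_space_SU3[OF that]])
      (simp_all add: bounded_bilinear.zero_right[OF bounded_bilinear_matrix_mult]
      bounded_bilinear.zero_left[OF bounded_bilinear_matrix_mult])
  moreover have "smooth_map SU3 ?U"
    by (intro smooth_map_add smooth_map_linear[OF _ smooth_map_ident]
        bounded_bilinear.bounded_linear_left[OF bounded_bilinear_matrix_mult]
        bounded_bilinear.bounded_linear_right[OF bounded_bilinear_matrix_mult])
  moreover have "?U (eta y) \<in> tangent_space (eta ` S5) (eta y)" if y: "y \<in> S5" for y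
  proof -
    have "cnj (herm y (a *v y)) = - herm y (a *v y)"
      using a(1) herm_matrix[of a y y] unfolding herm_cnj su3_def
      by (simp add: matrix_vector_mult_def herm_def sum_negf)
    then have "y \<bullet> (a *v y) = 0" by (simp add: inner_eq_Re_herm complex_eq_iff)
    then show ?thesis
      unfolding eta_infinitesimally_equivariant[OF a(1)] tangent_space_eta_image[OF y] by blast
  qed
  moreover have "?U (eta z) = u"
    unfolding eta_infinitesimally_equivariant[OF a(1)] a(2) uw ..
  ultimately show ?thesis
    by (intro exI[of _ ?U]) (auto simp: tangential_extension_def vector_fields_def)
qed

text \<open>
  A representative, modulo tangent vectors, of the covariant derivative of vector fields tangent to the
  submanifold with values \<open>d\<eta>(w)\<close> and \<open>d\<eta>(w')\<close>. The first two terms are the second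
  derivative of the quadratic map \<open>\<eta>\<close>, the third is the curvature of the sphere in \<open>\<complex>\<^sup>3\<close>, and the
  last comes from the connection of \<open>SU(3)\<close>.
\<close>

definition eta_second_fundamental :: "complex^3 \<Rightarrow> complex^3 \<Rightarrow> complex^3 \<Rightarrow> complex^3^3" where
  "eta_second_fundamental z w w' = outer w w' + outer w' w - (w \<bullet> w') *\<^sub>R eta_deriv z z
     - (1/2) *\<^sub>R (eta_deriv z w ** conj_transpose (eta z) ** eta_deriv z w'
                + eta_deriv z w' ** conj_transpose (eta z) ** eta_deriv z w)"

text \<open>
  Along a curve \<open>\<eta>(z)\<close> the field is \<open>V = d\<eta>\<^sub>z(y)\<close> with \<open>z \<bullet> y = 0\<close>. Differentiating
  both relations expresses \<open>V'\<close> by \<open>y'\<close>, where \<open>z \<bullet> y' = - w \<bullet> w'\<close>; so \<open>y'\<close> enters only through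
  \<open>d\<eta>\<^sub>z\<close> of \<open>y' + (w \<bullet> w') z\<close>, a tangent vector of the sphere.
\<close>

lemma connection_eq_eta_second_fundamental:
  assumes z: "z \<in> S5"
    and U: "tangential_extension SU3 (eta ` S5) (eta z) u U"
    and V: "tangential_extension SU3 (eta ` S5) (eta z) v V"
  shows "SU3_connection U V (eta z) - eta_second_fundamental z (eta_coord u) (eta_coord v)
    \<in> tangent_space (eta ` S5) (eta z)"
proof -
  let ?S = "eta ` S5" and ?p = "eta z" and ?w = "eta_coord u" and ?w' = "eta_coord v"
  have p: "?p \<in> ?S" using z by blast
  have SM: "?S \<subseteq> SU3" using eta_in_SU3 by blast
  have Up: "U ?p = u" and Vp: "V ?p = v" and VF: "V \<in> vector_fields SU3"
    and VS: "\<And>q. q \<in> ?S \<Longrightarrow> V q \<in> tangent_space ?S q"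
    and uT: "u \<in> tangent_space ?S ?p" and vT: "v \<in> tangent_space ?S ?p"
    using U V p by (auto simp: tangential_extension_def)
  have uw: "u = eta_deriv z ?w" and vw: "v = eta_deriv z ?w'"
    using uT vT unfolding tangent_space_eta_image[OF z] by auto
  obtain c e where c: "smooth_curve_in ?S c e ?p u" using uT by (auto simp: tangent_space_iff)
  then have cM: "smooth_curve_in SU3 c e ?p u" using SM unfolding smooth_curve_in_def by blast
  have c0: "c 0 = ?p" using c by (simp add: smooth_curve_in_def)
  let ?z = "\<lambda>t. eta_coord (c t)" and ?y = "\<lambda>t. eta_coord (V (c t))"
  let ?D = "differential SU3 V ?p u" and ?x = "eta_coord (differential SU3 V ?p u)"
  have ev: "\<forall>\<^sub>F t in nhds 0. V (c t) = eta_deriv (?z t) (?y t) \<and> ?z t \<bullet> ?y t = 0"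
    using smooth_curve_in_eventually[OF c]
  proof eventually_elim
    case (elim t)
    then obtain y where "y \<in> S5" "c t = eta y" by blast
    then show ?case using VS[OF elim] by (auto simp: tangent_space_eta_image)
  qed
  have D: "((\<lambda>t. V (c t)) has_vector_derivative ?D) (at 0)"
    using has_vector_derivative_along_curve[OF cM vector_fieldsD(3)[OF VF]] p SM by blast
  have z': "(?z has_vector_derivative ?w) (at 0)"
    using bounded_linear.has_vector_derivative[OF bounded_linear_eta_coord
        smooth_curve_in_vector_derivative[OF c]] .
  have y': "(?y has_vector_derivative ?x) (at 0)"
    using bounded_linear.has_vector_derivative[OF bounded_linear_eta_coord D] .
  note outer' = bounded_bilinear.has_vector_derivative[OF bounded_bilinear_outer]
  have "?D = (outer z ?x + outer ?w ?w') + (outer ?w' ?w + outer ?x z) + skew ?x"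
    using vector_derivative_eqI[OF D has_vector_derivative_add[OF
        has_vector_derivative_add[OF outer'[OF z' y'] outer'[OF y' z']]
        bounded_linear.has_vector_derivative[OF bounded_linear_skew y']] eventually_mono[OF ev]]
    by (simp add: c0 Vp eta_deriv_def)
  then have "?D = eta_deriv z ?x + (outer ?w ?w' + outer ?w' ?w)"
    by (simp only: eta_deriv_def ac_simps)
  then have D_eq: "?D - (outer ?w ?w' + outer ?w' ?w) = eta_deriv z ?x"
    by (metis add_diff_cancel_right')
  have "z \<bullet> ?x + ?w \<bullet> ?w' = 0"
    using vector_derivative_eqI[OF bounded_bilinear.has_vector_derivative[OF bounded_bilinear_inner z' y']
        has_vector_derivative_const[of 0] eventually_mono[OF ev]]
    by (simp add: c0 Vp)
  then have perp: "z \<bullet> (?x + (?w \<bullet> ?w') *\<^sub>R z) = 0"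
    using z by (simp add: inner_add_right dot_square_norm)
  have "SU3_connection U V ?p - eta_second_fundamental z ?w ?w'
      = (?D - (outer ?w ?w' + outer ?w' ?w)) + (?w \<bullet> ?w') *\<^sub>R eta_deriv z z"
    unfolding eta_second_fundamental_def SU3_connection_def Up Vp uw[symmetric] vw[symmetric]
    by simp
  also have "\<dots> = eta_deriv z ?x + (?w \<bullet> ?w') *\<^sub>R eta_deriv z z"
    unfolding D_eq ..
  also have "\<dots> = eta_deriv z (?x + (?w \<bullet> ?w') *\<^sub>R z)"
    by (simp add: linear_add[OF linear_eta_deriv] linear_scale[OF linear_eta_deriv])
  also have "\<dots> \<in> tangent_space ?S ?p"
    using perp unfolding tangent_space_eta_image[OF z] by blast
  finally show ?thesis .
qed

lemma eta_second_fundamental_equivariant: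
  assumes k: "k \<in> SU3"
  shows "eta_second_fundamental (k *v z) (k *v w) (k *v w')
    = k ** eta_second_fundamental z w w' ** transpose k"
proof -
  have kt: "transpose k ** conj_transpose (transpose k) = mat 1"
    by (rule SU3_right_inverse[OF SU3_transpose[OF k]])
  have tr: "(k ** u ** transpose k) ** conj_transpose (k ** p ** transpose k) ** (k ** v ** transpose k)
     = k ** (u ** conj_transpose p ** v) ** transpose k" for u p v
  proof -
    have "(k ** u ** transpose k) ** conj_transpose (k ** p ** transpose k) ** (k ** v ** transpose k)
      = k ** u ** (transpose k ** conj_transpose (transpose k)) ** conj_transpose p
        ** (conj_transpose k ** k) ** v ** transpose k"
      by (simp only: conj_transpose_mult matrix_mul_assoc)
    then show ?thesis by (simp add: kt SU3_left_inverse[OF k] matrix_mul_assoc)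
  qed
  show ?thesis
    unfolding eta_second_fundamental_def eta_deriv_equivariant[OF k] eta_equivariant[OF k] tr
      outer_equivariant SU3_inner[OF k]
    by (simp only: matrix_mult_simps)
qed

lemma bounded_bilinear_eta_second_fundamental:
  "bounded_bilinear (\<lambda>u v. eta_second_fundamental z (eta_coord u) (eta_coord v))"
proof -
  have lz: "linear eta_coord" by (rule bounded_linear.linear[OF bounded_linear_eta_coord])
  have sym: "eta_second_fundamental z w w' = eta_second_fundamental z w' w" for w w'
    by (simp add: eta_second_fundamental_def inner_commute add.commute)
  interpret o: bounded_bilinear outer by (rule bounded_bilinear_outer)
  have lin: "linear (\<lambda>u. eta_second_fundamental z (eta_coord u) w)" for w
  proof (rule linearI)
    show "eta_second_fundamental z (eta_coord (u + v)) w
        = eta_second_fundamental z (eta_coord u) w + eta_second_fundamental z (eta_coord v) w" for u v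
      by (simp add: eta_second_fundamental_def linear_add[OF lz] linear_add[OF linear_eta_deriv]
          o.add_left o.add_right matrix_mult_simps inner_add_left algebra_simps)
    show "eta_second_fundamental z (eta_coord (r *\<^sub>R u)) w
        = r *\<^sub>R eta_second_fundamental z (eta_coord u) w" for r u
      by (simp add: eta_second_fundamental_def linear_scale[OF lz] linear_scale[OF linear_eta_deriv]
          o.scaleR_left o.scaleR_right matrix_mult_simps algebra_simps)
  qed
  moreover have "linear (\<lambda>v. eta_second_fundamental z w (eta_coord v))" for w
    using lin[of w] by (subst sym)
  ultimately show ?thesis
    unfolding bilinear_conv_bounded_bilinear[symmetric] by (simp add: bilinear_def)
qed

text \<open>
  Two elements of the stabilizer suffice, \<open>diag(1, i, -i)\<close> and the rotation by a quarter turn in the last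
  two coordinates: they are two anticommuting quaternion units in \<open>SU(2)\<close>. Their square
  \<open>diag(1, -1, -1)\<close> is \<open>-1\<close> on the part \<open>\<complex>\<^sup>2\<close>, and they have no common fixed vector in \<open>su(2)\<close>. What
  remains is the line of the \<open>diag(-2 \<beta>, \<beta>, \<beta>) \<eta>(e1)\<close> with imaginary \<open>\<beta>\<close>, which is the image
  under \<open>d\<eta>\<close> of the Hopf direction \<open>- \<beta> e1\<close>.
\<close>

lemma isotropy_fixed_at_e1:
  assumes h: "h \<in> tangent_space SU3 (eta e1)"
    and fixed: "\<And>k. k \<in> SU3 \<Longrightarrow> k *v e1 = e1 \<Longrightarrow> k ** h ** transpose k = h"
  obtains w where "e1 \<bullet> w = 0" "h = eta_deriv e1 w"
proof -
  let ?k1 = "vector [vector [1, 0, 0], vector [0, \<i>, 0], vector [0, 0, - \<i>]] :: complex^3^3"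
  let ?k2 = "vector [vector [1, 0, 0], vector [0, 0, 1], vector [0, -1, 0]] :: complex^3^3"
  note defs = conj_transpose_def matrix_matrix_mult_def transpose_def matrix_vector_mult_def vec_eq_iff forall_3 sum_3
  \<comment> \<open>Only the entries (1,1), (2,3) and (3,2) are multiplied by 1 under this action.\<close>
  have "?k1 ** h ** transpose ?k1 = h"
    by (rule fixed) (simp_all add: defs SU3_def det_3 mat_def e1_def)
  then have k1: "h$1$2 = 0" "h$1$3 = 0" "h$2$1 = 0" "h$3$1 = 0" "h$2$2 = 0" "h$3$3 = 0"
    by (auto simp: defs complex_eq_iff)
  \<comment> \<open>On the remaining entries the quarter turn exchanges (2,3) and (3,2) with a sign.\<close>
  have "?k2 ** h ** transpose ?k2 = h"
    by (rule fixed) (simp_all add: defs SU3_def det_3 mat_def e1_def)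
  then have k2: "h$2$3 = - h$3$2"
    by (auto simp: defs)
  have "conj_transpose (eta e1) ** h \<in> su3" by (rule tangent_space_SU3_imp_su3[OF h])
  then have "cnj (h$3$2) = - h$3$2" "2 * h$3$2 + h$1$1 = 0"
    by (auto simp: su3_def defs trace_def eta_def e1_def k1 k2 algebra_simps)
  then have "cnj (h$3$2) = - h$3$2" "h$1$1 = - 2 * h$3$2"
    by (simp_all add: eq_neg_iff_add_eq_0 add.commute)
  then show ?thesis
    by (intro that[of "vector [- h$3$2, 0, 0]"])
      (simp_all add: inner_eq_Re_herm herm_def sum_3 e1_def eta_deriv_def outer_def skew_def vec_eq_iff forall_3
        k1 k2 complex_eq_iff)
qed

text \<open>Transport to the base point by equivariance; the stabilizers are conjugate.\<close>

lemma isotropy_fixed_tangent: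
  assumes z: "z \<in> S5" and h: "h \<in> tangent_space SU3 (eta z)"
    and fixed: "\<And>k. k \<in> SU3 \<Longrightarrow> k *v z = z \<Longrightarrow> k ** h ** transpose k = h"
  shows "h \<in> tangent_space (eta ` S5) (eta z)"
proof -
  obtain A where A: "A \<in> SU3" "A *v e1 = z" using SU3_transitive[of z] z by auto
  let ?B = "conj_transpose A" and ?h = "conj_transpose A ** h ** transpose (conj_transpose A)"
  have B: "?B \<in> SU3" by (rule SU3_conj_transpose[OF A(1)])
  have Bz: "?B *v z = e1"
    using A by (simp add: matrix_vector_mul_assoc SU3_left_inverse flip: A(2))
  have AhA: "A ** ?h ** transpose A = h"
  proof -
    have "A ** ?h ** transpose A = (A ** ?B) ** h ** transpose (A ** ?B)"
      by (simp only: matrix_transpose_mul matrix_mul_assoc)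
    then show ?thesis by (simp add: SU3_right_inverse[OF A(1)])
  qed
  have "?h \<in> tangent_space SU3 (?B ** eta z ** transpose ?B)"
    by (intro tangent_space_SU3_translate SU3_transpose B h)
  then have "?h \<in> tangent_space SU3 (eta e1)"
    by (simp add: Bz flip: eta_equivariant[OF B])
  moreover have "k ** ?h ** transpose k = ?h" if k: "k \<in> SU3" "k *v e1 = e1" for k
  proof -
    have "A ** k ** ?B \<in> SU3" by (intro SU3_mult A(1) k B)
    moreover have "(A ** k ** ?B) *v z = z"
      using A k Bz by (metis matrix_vector_mul_assoc)
    ultimately have "(A ** k ** ?B) ** h ** transpose (A ** k ** ?B) = h" by (rule fixed)
    then have "?h = ?B ** ((A ** k ** ?B) ** h ** transpose (A ** k ** ?B)) ** transpose ?B"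
      by (simp only:)
    also have "\<dots> = (?B ** A) ** (k ** ?h ** transpose k) ** transpose (?B ** A)"
      by (simp only: matrix_transpose_mul matrix_mul_assoc)
    also have "\<dots> = k ** ?h ** transpose k"
      unfolding SU3_left_inverse[OF A(1)] by simp
    finally show ?thesis ..
  qed
  ultimately obtain w where w: "e1 \<bullet> w = 0" "?h = eta_deriv e1 w"
    by (rule isotropy_fixed_at_e1)
  have "h = eta_deriv z (A *v w)"
    using eta_deriv_equivariant[OF A(1), of e1 w] AhA w(2) A(2) by simp
  moreover have "z \<bullet> (A *v w) = 0" using SU3_inner[OF A(1), of e1 w] A(2) w(1) by simp
  ultimately show ?thesis unfolding tangent_space_eta_image[OF z] by blast
qed


section \<open>Orthonormal bases and traces\<close>

lemma orthonormal_expansion: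
  fixes b :: "'a::real_vector \<Rightarrow> 'a \<Rightarrow> real"
  assumes lin: "\<And>y. linear (\<lambda>x. b x y)" and B: "finite B"
    and on: "\<And>x y. x \<in> B \<Longrightarrow> y \<in> B \<Longrightarrow> b x y = (if x = y then 1 else 0)" and u: "u \<in> span B"
  shows "u = (\<Sum>x\<in>B. b u x *\<^sub>R x)"
  using u
proof (induction rule: span_induct_alt)
  case base
  show ?case by (simp add: linear_0[OF lin])
next
  case (step c y v)
  have "(\<Sum>x\<in>B. b y x *\<^sub>R x) = (\<Sum>x\<in>B. if y = x then x else 0)"
    using step.hyps on by (intro sum.cong) auto
  also have "\<dots> = y" using B step.hyps by simp
  finally have "(\<Sum>x\<in>B. b (c *\<^sub>R y + v) x *\<^sub>R x) = c *\<^sub>R y + (\<Sum>x\<in>B. b v x *\<^sub>R x)"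
    by (simp add: linear_add[OF lin] linear_scale[OF lin] scaleR_add_left sum.distrib
        flip: scaleR_scaleR scaleR_sum_right)
  then show ?case using step.IH by simp
qed

text \<open>
  Expanding \<open>x\<close> in \<open>C\<close> turns the left sum into one over the coefficients \<open>b x y * b x y'\<close>, and summing these
  over \<open>x\<close> recovers the expansion of \<open>b y y'\<close> in \<open>B\<close>.
\<close>

lemma trace_basis_independent:
  fixes b :: "'a::real_vector \<Rightarrow> 'a \<Rightarrow> real" and Q :: "'a \<Rightarrow> 'a \<Rightarrow> 'b::real_vector"
  assumes lin: "\<And>y. linear (\<lambda>x. b x y)" and sym: "\<And>x y. b x y = b y x"
    and B: "finite B" "\<And>x y. x \<in> B \<Longrightarrow> y \<in> B \<Longrightarrow> b x y = (if x = y then 1 else 0)"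
    and C: "finite C" "\<And>x y. x \<in> C \<Longrightarrow> y \<in> C \<Longrightarrow> b x y = (if x = y then 1 else 0)"
    and span: "span B = span C"
    and Q: "\<And>y. linear (\<lambda>x. Q x y)" "\<And>x. linear (Q x)"
  shows "(\<Sum>x\<in>B. Q x x) = (\<Sum>y\<in>C. Q y y)"
proof -
  have Qx: "Q x x = (\<Sum>y\<in>C. \<Sum>y'\<in>C. (b x y * b x y') *\<^sub>R Q y y')" if "x \<in> B" for x
  proof -
    have x: "x = (\<Sum>y\<in>C. b x y *\<^sub>R y)"
      using that span by (intro orthonormal_expansion[OF lin C]) (auto intro: span_base)
    have "Q y x = (\<Sum>y'\<in>C. b x y' *\<^sub>R Q y y')" for y
      using arg_cong[OF x, of "Q y"] by (simp add: linear_sum[OF Q(2)] linear_scale[OF Q(2)])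
    moreover have "Q x x = (\<Sum>y\<in>C. b x y *\<^sub>R Q y x)"
      using arg_cong[OF x, of "\<lambda>u. Q u x"] by (simp add: linear_sum[OF Q(1)] linear_scale[OF Q(1)])
    ultimately show ?thesis by (simp add: scaleR_sum_right)
  qed
  have delta: "(\<Sum>x\<in>B. b x y * b x y') = (if y = y' then 1 else 0)" if y: "y \<in> C" "y' \<in> C" for y y'
  proof -
    have "y = (\<Sum>x\<in>B. b y x *\<^sub>R x)"
      using y(1) span by (intro orthonormal_expansion[OF lin B]) (auto intro: span_base)
    then have "b y y' = b (\<Sum>x\<in>B. b y x *\<^sub>R x) y'" by simp
    also have "\<dots> = (\<Sum>x\<in>B. b x y * b x y')"
      by (simp add: linear_sum[OF lin] linear_scale[OF lin] sym[of y])
    finally show ?thesis using C(2)[OF y] by simp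
  qed
  have "(\<Sum>x\<in>B. Q x x) = (\<Sum>x\<in>B. \<Sum>y\<in>C. \<Sum>y'\<in>C. (b x y * b x y') *\<^sub>R Q y y')"
    using Qx by simp
  also have "\<dots> = (\<Sum>y\<in>C. \<Sum>x\<in>B. \<Sum>y'\<in>C. (b x y * b x y') *\<^sub>R Q y y')"
    by (rule sum.swap)
  also have "\<dots> = (\<Sum>y\<in>C. \<Sum>y'\<in>C. \<Sum>x\<in>B. (b x y * b x y') *\<^sub>R Q y y')"
    by (intro sum.cong refl sum.swap)
  also have "\<dots> = (\<Sum>y\<in>C. \<Sum>y'\<in>C. (if y = y' then 1 else 0) *\<^sub>R Q y y')"
    by (intro sum.cong refl) (simp add: delta flip: scaleR_sum_left)
  also have "\<dots> = (\<Sum>y\<in>C. \<Sum>y'\<in>C. if y = y' then Q y y' else 0)"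
    by (intro sum.cong refl) simp
  also have "\<dots> = (\<Sum>y\<in>C. Q y y)" using C(1) by simp
  finally show ?thesis .
qed

text \<open>Gram-Schmidt for a symmetric bilinear form that is positive on a subspace only.\<close>

lemma orthonormal_basis_exists:
  fixes b :: "'a::real_vector \<Rightarrow> 'a \<Rightarrow> real"
  assumes lin: "\<And>y. linear (\<lambda>x. b x y)" and sym: "\<And>x y. b x y = b y x"
    and V: "subspace V" and pos: "\<And>x. x \<in> V \<Longrightarrow> x \<noteq> 0 \<Longrightarrow> b x x > 0"
    and F: "finite F" "F \<subseteq> V"
  shows "\<exists>B. finite B \<and> span B = span F \<and> (\<forall>x\<in>B. \<forall>y\<in>B. b x y = (if x = y then 1 else 0))"
  using F
proof (induction F rule: finite_induct)
  case empty
  show ?case by (intro exI[of _ "{}"]) simp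
next
  case (insert a F)
  then obtain B where B: "finite B" "span B = span F"
      "\<forall>x\<in>B. \<forall>y\<in>B. b x y = (if x = y then 1 else 0)" by auto
  show ?case
  proof (cases "a \<in> span B")
    case True
    then show ?thesis using B by (intro exI[of _ B]) (auto simp: span_redundant)
  next
    case False
    define c where "c = (\<Sum>x\<in>B. b a x *\<^sub>R x)"
    define u where "u = a - c"
    have c: "c \<in> span B" unfolding c_def by (intro span_sum span_scale span_base)
    have u0: "u \<noteq> 0" using False c by (auto simp: u_def)
    have "c \<in> V" using c B(2) insert.prems V by (metis insert_subset span_minimal subsetD)
    then have "u \<in> V" using insert.prems V by (auto simp: u_def intro: subspace_diff)
    with pos u0 have uu: "b u u > 0" by blast
    have ux: "b u x = 0" if "x \<in> B" for x
    proof -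
      have "b c x = (\<Sum>y\<in>B. b a y * (if y = x then 1 else 0))"
        unfolding c_def using B(3) that by (simp add: linear_sum[OF lin] linear_scale[OF lin])
      also have "\<dots> = b a x" using B(1) that by (simp add: if_distrib cong: if_cong)
      finally show ?thesis by (simp add: u_def linear_diff[OF lin])
    qed
    define e where "e = u /\<^sub>R sqrt (b u u)"
    have ee: "b e e = 1"
    proof -
      have "b e e = inverse (sqrt (b u u)) * (inverse (sqrt (b u u)) * b u u)"
        by (simp add: e_def linear_scale[OF lin] sym[of u "_ *\<^sub>R _"])
      also have "\<dots> = b u u / (sqrt (b u u) * sqrt (b u u))"
        by (simp only: divide_inverse inverse_mult_distrib ac_simps)
      finally show ?thesis using uu by simp
    qed
    have ex: "b e x = 0" "b x e = 0" if "x \<in> B" for x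
      using ux[OF that] sym[of x] by (simp_all add: e_def linear_scale[OF lin])
    have "span (insert e B) = span (insert a F)"
    proof -
      have "sqrt (b u u) *\<^sub>R e = u" using uu by (simp add: e_def)
      then have a: "a = sqrt (b u u) *\<^sub>R e + c" by (simp add: u_def)
      have cx: "c \<in> span (insert x B)" for x
        using c span_mono[of B "insert x B"] by blast
      have "a \<in> span (insert e B)"
        unfolding a by (rule span_add[OF span_scale[OF span_base] cx]) simp
      moreover have "e \<in> span (insert a B)"
        unfolding e_def u_def by (rule span_scale[OF span_diff[OF span_base cx]]) simp
      ultimately have "span (insert e B) = span (insert a B)"
        by (intro span_eq[THEN iffD2] conjI) (auto intro: span_base)
      also have "\<dots> = span (insert a F)"
        using B(2) by (simp add: span_insert)
      finally show ?thesis .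
    qed
    moreover have "\<forall>x\<in>insert e B. \<forall>y\<in>insert e B. b x y = (if x = y then 1 else 0)"
      using B(3) ee ex by (metis insert_iff zero_neq_one)
    ultimately show ?thesis using B(1) by (intro exI[of _ "insert e B"]) auto
  qed
qed

lemma normal_part_eq:
  assumes g: "riemannian_metric M g" and p: "p \<in> M" and M: "subspace (tangent_space M p)"
    and S: "tangent_space S p \<subseteq> tangent_space M p" "subspace (tangent_space S p)"
    and n: "n \<in> tangent_space M p" "\<And>t. t \<in> tangent_space S p \<Longrightarrow> g p n t = 0"
      "w - n \<in> tangent_space S p"
  shows "normal_part M g S p w = n"
  unfolding normal_part_def
proof (rule the_equality)
  fix m assume m: "m \<in> tangent_space M p \<and> (\<forall>t\<in>tangent_space S p. g p m t = 0) \<and> w - m \<in> tangent_space S p"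
  have "(w - n) - (w - m) \<in> tangent_space S p" using m n(3) subspace_diff[OF S(2)] by blast
  then have d: "m - n \<in> tangent_space S p" by simp
  have "g p (m - n) (m - n) = g p m (m - n) - g p n (m - n)"
    using m n d S(1) by (intro riemannian_metric_diff_left[OF g M p]) auto
  also have "\<dots> = 0" using m n(2)[OF d] d by simp
  finally have "\<not> g p (m - n) (m - n) > 0" by simp
  then show "m = n"
    using g p d S(1) unfolding riemannian_metric_def by (metis eq_iff_diff_eq_0 subsetD)
qed (use n in auto)


section \<open>The mean curvature\<close>

context bi_invariant_SU3
begin

text \<open>The metric at \<open>p\<close>, extended from the tangent space to all matrices.\<close>

definition metric_at :: "complex^3^3 \<Rightarrow> complex^3^3 \<Rightarrow> complex^3^3 \<Rightarrow> real" where
  "metric_at p u v = inner_one (conj_transpose p ** u) (conj_transpose p ** v)"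

lemma linear_metric_at: "linear (\<lambda>u. metric_at p u v)"
  unfolding metric_at_def
  by (intro linearI) (simp_all add: matrix_mult_simps bounded_bilinear.add_left[OF bounded_bilinear_inner_one]
      bounded_bilinear.scaleR_left[OF bounded_bilinear_inner_one])

lemma metric_at_sym: "metric_at p u v = metric_at p v u"
  unfolding metric_at_def by (rule inner_one_sym)

lemma metric_at_eq:
  "p \<in> SU3 \<Longrightarrow> u \<in> tangent_space SU3 p \<Longrightarrow> v \<in> tangent_space SU3 p \<Longrightarrow> g p u v = metric_at p u v"
  unfolding metric_at_def by (rule g_eq_inner_one)

lemma orthonormal_tangent_basis_exists:
  assumes p: "p \<in> SU3" and S: "tangent_space S p \<subseteq> tangent_space SU3 p" "subspace (tangent_space S p)"
  shows "\<exists>B. orthonormal_tangent_basis g S p B"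
proof -
  obtain F where F: "finite F" "F \<subseteq> tangent_space S p" "span F = tangent_space S p"
    using basis_exists[of "tangent_space S p"] S(2) finiteI_independent
    by (metis span_subspace)
  have pos: "metric_at p x x > 0" if "x \<in> tangent_space SU3 p" "x \<noteq> 0" for x
    using metric p that metric_at_eq[OF p that(1) that(1)] unfolding riemannian_metric_def by metis
  obtain B where B: "finite B" "span B = span F"
      "\<forall>x\<in>B. \<forall>y\<in>B. metric_at p x y = (if x = y then 1 else 0)"
    using orthonormal_basis_exists[of "metric_at p", OF linear_metric_at metric_at_sym
        subspace_tangent_space_SU3[OF p] pos F(1)] F(2) S(1) by blast
  have "B \<subseteq> tangent_space SU3 p" using B(2) F(3) S(1) span_superset by blast
  then have "\<forall>x\<in>B. \<forall>y\<in>B. g p x y = (if x = y then 1 else 0)"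
    using B(3) metric_at_eq[OF p] by (metis subsetD)
  then show ?thesis using B F(3) by (auto simp: orthonormal_tangent_basis_def)
qed

lemma normal_part_eq_projection:
  assumes p: "p \<in> SU3" and S: "tangent_space S p \<subseteq> tangent_space SU3 p" "subspace (tangent_space S p)"
    and B: "orthonormal_tangent_basis g S p B" and w: "w \<in> tangent_space SU3 p"
  shows "normal_part SU3 g S p w = w - (\<Sum>x\<in>B. metric_at p w x *\<^sub>R x)"
proof (rule normal_part_eq[OF metric p subspace_tangent_space_SU3[OF p] S])
  let ?c = "\<Sum>x\<in>B. metric_at p w x *\<^sub>R x"
  have fin: "finite B" and span: "span B = tangent_space S p" using B by (auto simp: orthonormal_tangent_basis_def)
  have BT: "B \<subseteq> tangent_space SU3 p" using span S(1) span_superset by blast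
  have on: "metric_at p x y = (if x = y then 1 else 0)" if "x \<in> B" "y \<in> B" for x y
    using B that BT metric_at_eq[OF p, of x y] unfolding orthonormal_tangent_basis_def by (metis subsetD)
  have c: "?c \<in> tangent_space S p" unfolding span[symmetric] by (intro span_sum span_scale span_base)
  then show "w - (w - ?c) \<in> tangent_space S p" by simp
  show n: "w - ?c \<in> tangent_space SU3 p"
    using c S(1) w by (intro subspace_diff[OF subspace_tangent_space_SU3[OF p]]) auto
  fix t assume t: "t \<in> tangent_space S p"
  have "t = (\<Sum>x\<in>B. metric_at p t x *\<^sub>R x)"
    by (rule orthonormal_expansion[of "metric_at p", OF linear_metric_at fin on]) (use t span in auto)
  from arg_cong[OF this, of "\<lambda>u. metric_at p u w"]
  have "metric_at p t w = metric_at p (\<Sum>x\<in>B. metric_at p t x *\<^sub>R x) w" .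
  also have "\<dots> = (\<Sum>x\<in>B. metric_at p w x * metric_at p x t)"
    by (simp add: linear_sum[OF linear_metric_at] linear_scale[OF linear_metric_at] metric_at_sym[of p t]
        metric_at_sym[of p _ w] mult.commute)
  also have "\<dots> = metric_at p ?c t"
    by (simp add: linear_sum[OF linear_metric_at] linear_scale[OF linear_metric_at])
  finally have "metric_at p (w - ?c) t = 0"
    by (simp add: linear_diff[OF linear_metric_at] metric_at_sym[of p w])
  then show "g p (w - ?c) t = 0" using metric_at_eq[OF p n] t S(1) by auto
qed

text \<open>The normal part is an orthogonal projection with the tangent space as its kernel, hence additive.\<close>

lemma sum_normal_part_eq_0:
  assumes p: "p \<in> SU3" and S: "tangent_space S p \<subseteq> tangent_space SU3 p" "subspace (tangent_space S p)"
    and B: "orthonormal_tangent_basis g S p B"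
    and W: "\<And>i. i \<in> I \<Longrightarrow> W i \<in> tangent_space SU3 p" "(\<Sum>i\<in>I. W i) \<in> tangent_space S p"
  shows "(\<Sum>i\<in>I. normal_part SU3 g S p (W i)) = 0"
proof -
  let ?h = "\<Sum>i\<in>I. W i"
  have "?h \<in> tangent_space SU3 p" using W S(1) by blast
  have "(\<Sum>i\<in>I. normal_part SU3 g S p (W i)) = (\<Sum>i\<in>I. W i - (\<Sum>x\<in>B. metric_at p (W i) x *\<^sub>R x))"
    using normal_part_eq_projection[OF p S B] W(1) by simp
  also have "\<dots> = ?h - (\<Sum>x\<in>B. \<Sum>i\<in>I. metric_at p (W i) x *\<^sub>R x)"
    unfolding sum_subtractf by (subst sum.swap) simp
  also have "\<dots> = ?h - (\<Sum>x\<in>B. metric_at p ?h x *\<^sub>R x)"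
    by (simp add: linear_sum[OF linear_metric_at] scaleR_sum_left)
  also have "\<dots> = normal_part SU3 g S p ?h"
    using normal_part_eq_projection[OF p S B] W S(1) by auto
  also have "\<dots> = 0"
  proof (rule normal_part_eq[OF metric p subspace_tangent_space_SU3[OF p] S])
    show "0 \<in> tangent_space SU3 p" by (rule tangent_space_zero[OF p])
    have lin: "linear (\<lambda>u. metric_at p u t)" for t by (rule linear_metric_at)
    show "g p 0 t = 0" if "t \<in> tangent_space S p" for t
      using metric_at_eq[OF p tangent_space_zero[OF p], of t] that S(1) linear_0[OF lin] by auto
  qed (use W in simp)
  finally show ?thesis .
qed

text \<open>
  The stabilizer maps orthonormal bases of the tangent space to orthonormal bases, so equivariance of the
  form and basis independence of its trace give the invariance of the trace.
\<close>

lemma trace_second_fundamental_isotropy_invariant: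
  assumes z: "z \<in> S5" and B: "orthonormal_tangent_basis g (eta ` S5) (eta z) B"
    and k: "k \<in> SU3" "k *v z = z"
  defines "Q \<equiv> \<lambda>u v. eta_second_fundamental z (eta_coord u) (eta_coord v)"
  shows "k ** (\<Sum>x\<in>B. Q x x) ** transpose k = (\<Sum>x\<in>B. Q x x)"
proof -
  let ?p = "eta z" and ?T = "tangent_space (eta ` S5) (eta z)"
  define \<phi> where "\<phi> u = k ** u ** transpose k" for u
  have p: "?p \<in> SU3" by (rule eta_in_SU3[OF z])
  have TM: "?T \<subseteq> tangent_space SU3 ?p" by (intro tangent_space_mono) (use eta_in_SU3 in auto)
  have fin: "finite B" and span: "span B = ?T"
    and gB: "\<And>x y. x \<in> B \<Longrightarrow> y \<in> B \<Longrightarrow> g ?p x y = (if x = y then 1 else 0)"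
    using B by (auto simp: orthonormal_tangent_basis_def)
  have BT: "B \<subseteq> ?T" using span span_superset by blast
  then have BM: "x \<in> tangent_space SU3 ?p" if "x \<in> B" for x using TM that by blast
  have lin: "linear \<phi>" by (rule linearI) (simp_all add: \<phi>_def matrix_mult_simps)
  have \<phi>T: "k' ** u ** transpose k' \<in> ?T \<and> eta_coord (k' ** u ** transpose k') = k' *v eta_coord u"
    if "k' \<in> SU3" "k' *v z = z" "u \<in> ?T" for k' u
  proof -
    obtain w where w: "z \<bullet> w = 0" "u = eta_deriv z w"
      using \<open>u \<in> ?T\<close> unfolding tangent_space_eta_image[OF z] by blast
    have "k' ** u ** transpose k' = eta_deriv z (k' *v w)"
      using eta_deriv_equivariant[OF that(1), of z w] by (simp add: w that)
    moreover have "z \<bullet> (k' *v w) = 0" using SU3_inner[OF that(1), of z w] by (simp add: w that)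
    ultimately show ?thesis unfolding tangent_space_eta_image[OF z] by (auto simp: w)
  qed
  have k': "conj_transpose k \<in> SU3" "conj_transpose k *v z = z"
    using k SU3_conj_transpose[OF k(1)] by auto
      (metis SU3_left_inverse matrix_vector_mul_assoc matrix_vector_mul_lid)
  have inv: "\<phi> (conj_transpose k ** u ** transpose (conj_transpose k)) = u"
    "conj_transpose k ** \<phi> u ** transpose (conj_transpose k) = u" for u
  proof -
    have "\<phi> (conj_transpose k ** u ** transpose (conj_transpose k))
      = (k ** conj_transpose k) ** u ** transpose (k ** conj_transpose k)"
      unfolding \<phi>_def by (simp only: matrix_transpose_mul matrix_mul_assoc)
    then show "\<phi> (conj_transpose k ** u ** transpose (conj_transpose k)) = u"
      by (simp add: SU3_right_inverse[OF k(1)])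
    have "conj_transpose k ** \<phi> u ** transpose (conj_transpose k)
      = (conj_transpose k ** k) ** u ** transpose (conj_transpose k ** k)"
      unfolding \<phi>_def by (simp only: matrix_transpose_mul matrix_mul_assoc)
    then show "conj_transpose k ** \<phi> u ** transpose (conj_transpose k) = u"
      by (simp add: SU3_left_inverse[OF k(1)])
  qed
  have inj: "inj \<phi>" by (rule injI) (metis inv(2))
  have "\<phi> ` ?T = ?T"
  proof
    show "\<phi> ` ?T \<subseteq> ?T" using \<phi>T[OF k] by (auto simp: \<phi>_def)
    show "?T \<subseteq> \<phi> ` ?T" using \<phi>T[OF k'] inv(1) by (metis image_eqI subsetI)
  qed
  then have span\<phi>: "span (\<phi> ` B) = span B" by (simp add: linear_span_image[OF lin] span)
  have fixp: "k ** ?p ** transpose k = ?p" using eta_equivariant[OF k(1), of z] k(2) by simp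
  have gphi: "g ?p (\<phi> x) (\<phi> y) = g ?p x y" if "x \<in> ?T" "y \<in> ?T" for x y
  proof -
    have xy: "x \<in> tangent_space SU3 ?p" "y \<in> tangent_space SU3 ?p" using that TM by auto
    note translated = tangent_space_SU3_translate(1)[OF k(1) xy(1)] tangent_space_SU3_translate(1)[OF k(1) xy(2)]
    from g_right[OF SU3_transpose[OF k(1)] SU3_mult[OF k(1) p] translated] g_left[OF k(1) p xy]
    show ?thesis by (simp add: \<phi>_def fixp)
  qed
  have on: "metric_at ?p x y = (if x = y then 1 else 0)" if "x \<in> B" "y \<in> B" for x y
    using gB[OF that] metric_at_eq[OF p BM[OF that(1)] BM[OF that(2)]] by simp
  have on\<phi>: "metric_at ?p x y = (if x = y then 1 else 0)" if xy: "x \<in> \<phi> ` B" "y \<in> \<phi> ` B" for x y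
  proof -
    obtain x' y' where x': "x' \<in> B" "x = \<phi> x'" and y': "y' \<in> B" "y = \<phi> y'" using xy by blast
    have T: "x' \<in> ?T" "y' \<in> ?T" using x' y' BT by auto
    have "\<phi> x' \<in> tangent_space SU3 ?p" "\<phi> y' \<in> tangent_space SU3 ?p"
      using \<open>\<phi> ` ?T = ?T\<close> T TM by blast+
    then have "metric_at ?p x y = g ?p x' y'"
      using metric_at_eq[OF p, of "\<phi> x'" "\<phi> y'"] gphi[OF T] x' y' by simp
    then show ?thesis using gB x' y' inj by (simp add: inj_eq)
  qed
  have bQ: "bounded_bilinear Q" unfolding Q_def by (rule bounded_bilinear_eta_second_fundamental)
  have Q\<phi>: "k ** Q x x ** transpose k = Q (\<phi> x) (\<phi> x)" if "x \<in> B" for x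
  proof -
    have "eta_coord (\<phi> x) = k *v eta_coord x" using \<phi>T[OF k subsetD[OF BT that]] by (simp add: \<phi>_def)
    then show ?thesis
      using eta_second_fundamental_equivariant[OF k(1), of z] k(2) by (simp add: Q_def)
  qed
  have "k ** (\<Sum>x\<in>B. Q x x) ** transpose k = (\<Sum>x\<in>B. k ** Q x x ** transpose k)"
    using linear_sum[OF lin] by (simp add: \<phi>_def)
  also have "\<dots> = (\<Sum>x\<in>B. Q (\<phi> x) (\<phi> x))" using Q\<phi> by simp
  also have "\<dots> = (\<Sum>x\<in>\<phi> ` B. Q x x)"
    using inj by (simp add: sum.reindex inj_on_subset)
  also have "\<dots> = (\<Sum>x\<in>B. Q x x)"
    by (rule trace_basis_independent[of "metric_at ?p"])
      (use fin on on\<phi> span\<phi> linear_metric_at metric_at_sym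
        bounded_bilinear.bounded_linear_left[OF bQ] bounded_bilinear.bounded_linear_right[OF bQ]
        in \<open>auto simp: linear_conv_bounded_linear\<close>)
  finally show ?thesis .
qed

text \<open>
  The total covariant derivative over the basis differs from the trace of the equivariant form by a
  tangent vector, and that trace is itself tangent because the stabilizer fixes it.
\<close>

lemma mean_curvature_eta:
  assumes z: "z \<in> S5"
  shows "mean_curvature SU3 g (eta ` S5) (eta z) = 0"
proof -
  let ?S = "eta ` S5" and ?p = "eta z"
  let ?T = "tangent_space (eta ` S5) (eta z)"
  have p: "?p \<in> SU3" by (rule eta_in_SU3[OF z])
  have TM: "?T \<subseteq> tangent_space SU3 ?p" by (intro tangent_space_mono) (use eta_in_SU3 in auto)
  note sub = subspace_tangent_space_eta[OF z] and subM = subspace_tangent_space_SU3[OF p]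
  define B where "B = (SOME B. orthonormal_tangent_basis g ?S ?p B)"
  have B: "orthonormal_tangent_basis g ?S ?p B"
    unfolding B_def by (rule someI_ex[OF orthonormal_tangent_basis_exists[OF p TM sub]])
  have BT: "x \<in> ?T" if "x \<in> B" for x
    using B that span_superset unfolding orthonormal_tangent_basis_def by blast
  define U where "U x = (SOME U. tangential_extension SU3 ?S ?p x U)" for x
  have U: "tangential_extension SU3 ?S ?p x (U x)" if "x \<in> B" for x
    unfolding U_def by (rule someI_ex[OF tangential_extension_exists[OF z BT[OF that]]])
  have UV: "U x \<in> vector_fields SU3" if "x \<in> B" for x
    using U[OF that] by (simp add: tangential_extension_def)
  define W where "W x = SU3_connection (U x) (U x) ?p" for x
  define Q where "Q = (\<lambda>u v. eta_second_fundamental z (eta_coord u) (eta_coord v))"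
  have WT: "W x \<in> tangent_space SU3 ?p" if "x \<in> B" for x
    unfolding W_def by (intro SU3_connection_tangent UV that p)
  have WQ: "W x - Q x x \<in> ?T" if "x \<in> B" for x
    unfolding W_def Q_def by (rule connection_eq_eta_second_fundamental[OF z U[OF that] U[OF that]])
  let ?h = "\<Sum>x\<in>B. Q x x"
  have "Q x x \<in> tangent_space SU3 ?p" if "x \<in> B" for x
    using subspace_diff[OF subM WT[OF that], of "W x - Q x x"] WQ[OF that] TM by auto
  then have "?h \<in> tangent_space SU3 ?p" by (rule subspace_sum[OF subM])
  then have hT: "?h \<in> ?T"
    unfolding Q_def
    by (rule isotropy_fixed_tangent[OF z]) (rule trace_second_fundamental_isotropy_invariant[OF z B])
  have "(\<Sum>x\<in>B. W x - Q x x) + ?h \<in> ?T"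
    by (intro subspace_add[OF sub] subspace_sum[OF sub] WQ hT)
  then have "(\<Sum>x\<in>B. W x) \<in> ?T" by (simp add: sum_subtractf)
  then have "(\<Sum>x\<in>B. normal_part SU3 g ?S ?p (W x)) = 0"
    by (intro sum_normal_part_eq_0[OF p TM sub B] WT)
  moreover have "second_fundamental_form SU3 g ?S ?p x x = normal_part SU3 g ?S ?p (W x)" if "x \<in> B" for x
    unfolding second_fundamental_form_def W_def U_def[symmetric] by (simp add: levi_civita_SU3 UV that p)
  ultimately show ?thesis
    unfolding mean_curvature_def B_def[symmetric] by simp
qed

end

theorem proposition2p2:
  fixes g :: "complex^3^3 \<Rightarrow> complex^3^3 \<Rightarrow> complex^3^3 \<Rightarrow> real"
  assumes "bi_invariant_metric g"
  shows "minimal_embedding (sphere (0 :: complex^3) 1) SU3 g eta"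
proof -
  interpret bi_invariant_SU3 g by unfold_locales (rule assms)
  show ?thesis
    unfolding minimal_embedding_def using smooth_embedding_eta mean_curvature_eta by blast
qed

end
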